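(* Let $n\in\mathbb{N}$ and let $A\in\mathcal{S}_n\cup\mathcal{T}_n$. Then: (1) $Tr_2(A)\ge 6n-5$; (2) $Tr_{2^k}(A)\ \ge\ 2^{2^{k-1}}+(n-2)\,6^{2^{k-1}}+5^{2^{k-1}}$ for all $k\in\mathbb{N}$.
   Context: $\mathbb{N}$ denotes the positive integers. Trace measures: for a real $n\times n$ matrix $A$ with eigenvalues $\beta_1,\dots,\beta_n$ (with multiplicity) and $k\in\mathbb{N}$, $Tr_k(A)=\sum_{i=1}^n\beta_i^k$. Symmetrizable: a real square matrix $A$ is symmetrizable if there is a diagonal matrix $D$ with all diagonal entries positive such that $D^{-1}AD$ is a real symmetric matrix. Positive definite: a matrix is called positive definite if and only if all of its eigenvalues are totally positive, where an eigenvalue is totally positive if all of its conjugates (over $\mathbb{Q}$) are positive real numbers. Upper/lower diagonal: an $n\times n$ matrix $(a_{ij})$ has non-zero upper diagonal if $a_{i,i+1}\neq 0$ for all $1\le i\le n-1$, and non-zero lower diagonal if $a_{i+1,i}\ne 0$ for all $1\le i\le n-1$. Rational cycle condition: an $n\times n$ real matrix $(s_{ij})$ satisfies it if for every finite sequence $i_1,\dots,i_k\in\{1,\dots,n\}$ with $3\le k\le n$ one has $s_{i_1i_2}s_{i_2i_3}\cdots s_{i_ki_1}\in\mathbb{Q}$. $\mathcal{S}_n$ is the set of all $n\times n$ integer matrices that are symmetrizable and positive definite with non-zero upper and lower diagonal. $\mathcal{T}_n$ is the set of all $n\times n$ real symmetric matrices that are positive definite, have non-zero upper diagonal, have all entries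 in $\{\pm\sqrt{a}: a\in\mathbb{N}\}\cup\{0\}$, and satisfy the rational cycle condition. *)

theory Defs
  imports
    "HOL-Computational_Algebra.Fundamental_Theorem_Algebra"
    "Jordan_Normal_Form.Char_Poly"
begin

text \<open>Matrices are indexed from \<open>0\<close>, so the indices \<open>1, \<dots>, n\<close> become \<open>0, \<dots>, n - 1\<close>.
  The eigenvalues of a real matrix are taken in the complex numbers.\<close>

definition eigenvalues :: "real mat \<Rightarrow> complex multiset" where
  "eigenvalues A = proots (char_poly (map_mat complex_of_real A))"

text \<open>The power sum is always real for a real matrix, so \<open>Re\<close> loses nothing; see
  \<open>complex_of_real_Tr\<close> below.\<close>

definition Tr :: "nat \<Rightarrow> real mat \<Rightarrow> real" where
  "Tr k A = Re (\<Sum>\<beta>\<in>#eigenvalues A. \<beta> ^ k)"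

definition symmetric_mat :: "'a mat \<Rightarrow> bool" where
  "symmetric_mat A \<longleftrightarrow> transpose_mat A = A"

definition symmetrizable :: "real mat \<Rightarrow> bool" where
  "symmetrizable A \<longleftrightarrow> square_mat A \<and>
     (\<exists>D D'. D \<in> carrier_mat (dim_row A) (dim_row A) \<and> D' \<in> carrier_mat (dim_row A) (dim_row A) \<and>
        diagonal_mat D \<and> (\<forall>i<dim_row A. D $$ (i, i) > 0) \<and>
        inverts_mat D D' \<and> inverts_mat D' D \<and>
        symmetric_mat (D' * A * D))"

definition is_min_poly :: "complex \<Rightarrow> rat poly \<Rightarrow> bool" where
  "is_min_poly x p \<longleftrightarrow> lead_coeff p = 1 \<and> irreducible p \<and> poly (map_poly of_rat p) x = 0"

definition conjugate_over_Q :: "complex \<Rightarrow> complex \<Rightarrow> bool" where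
  "conjugate_over_Q x y \<longleftrightarrow> (\<exists>p. is_min_poly x p \<and> poly (map_poly of_rat p) y = 0)"

text \<open>Conjugates only make sense for algebraic numbers; a transcendental number has none and is
  excluded explicitly.\<close>

definition totally_positive :: "complex \<Rightarrow> bool" where
  "totally_positive x \<longleftrightarrow> algebraic x \<and> (\<forall>y. conjugate_over_Q x y \<longrightarrow> y \<in> \<real> \<and> Re y > 0)"

definition positive_definite :: "real mat \<Rightarrow> bool" where
  "positive_definite A \<longleftrightarrow> (\<forall>\<beta>\<in>#eigenvalues A. totally_positive \<beta>)"

definition nonzero_upper_diagonal :: "real mat \<Rightarrow> bool" where
  "nonzero_upper_diagonal A \<longleftrightarrow> (\<forall>i. i + 1 < dim_row A \<longrightarrow> A $$ (i, i + 1) \<noteq> 0)"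

definition nonzero_lower_diagonal :: "real mat \<Rightarrow> bool" where
  "nonzero_lower_diagonal A \<longleftrightarrow> (\<forall>i. i + 1 < dim_row A \<longrightarrow> A $$ (i + 1, i) \<noteq> 0)"

text \<open>The indices of the cycle need not be distinct.\<close>

definition rational_cycle_condition :: "real mat \<Rightarrow> bool" where
  "rational_cycle_condition A \<longleftrightarrow>
     (\<forall>is. 3 \<le> length is \<and> length is \<le> dim_row A \<and> set is \<subseteq> {..<dim_row A} \<longrightarrow>
        (\<Prod>j<length is. A $$ (is ! j, is ! ((j + 1) mod length is))) \<in> \<rat>)"

definition S_mats :: "nat \<Rightarrow> real mat set" where
  "S_mats n = {A \<in> carrier_mat n n. elements_mat A \<subseteq> \<int> \<and> symmetrizable A \<and> positive_definite A \<and>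
     nonzero_upper_diagonal A \<and> nonzero_lower_diagonal A}"

definition T_mats :: "nat \<Rightarrow> real mat set" where
  "T_mats n = {A \<in> carrier_mat n n. symmetric_mat A \<and> positive_definite A \<and>
     nonzero_upper_diagonal A \<and>
     elements_mat A \<subseteq> {sqrt (real a) |a. a \<ge> 1} \<union> {- sqrt (real a) |a. a \<ge> 1} \<union> {0} \<and>
     rational_cycle_condition A}"

lemma proots_map_poly_cnj: "proots (map_poly cnj p) = image_mset cnj (proots p)"
proof (cases "p = 0")
  case False
  interpret cnj: map_poly_comm_ring_hom cnj
    by unfold_locales auto
  have p: "p = Polynomial.smult (lead_coeff p) (\<Prod>x\<in>#proots p. [:- x, 1:])"
    using complex_poly_decompose_multiset[of p] by simp
  have 1: "map_poly cnj (\<Prod>x\<in>#M. [:- x, 1:]) = (\<Prod>x\<in>#M. [:- cnj x, 1:])" for M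
    by (induction M) (simp_all add: cnj.hom_mult del: mult_pCons_left)
  have 2: "proots (\<Prod>x\<in>#M. [:- cnj x, 1:]) = image_mset cnj M" for M
  proof (induction M)
    case (add x M)
    have "(\<Prod>x\<in>#M. [:- cnj x, 1:]) \<noteq> 0"
      by (auto simp: prod_mset_zero_iff)
    with add show ?case by (simp add: proots_mult del: mult_pCons_left)
  qed simp
  have "map_poly cnj p = Polynomial.smult (cnj (lead_coeff p)) (\<Prod>x\<in>#proots p. [:- cnj x, 1:])"
    by (subst p) (simp add: cnj.base.map_poly_hom_smult 1)
  then show ?thesis using False 2 by simp
qed simp

lemma complex_of_real_Tr:
  assumes "A \<in> carrier_mat n n"
  shows "complex_of_real (Tr k A) = (\<Sum>\<beta>\<in>#eigenvalues A. \<beta> ^ k)"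
proof -
  have "map_poly cnj (map_poly complex_of_real p) = map_poly complex_of_real p" for p
    by (intro poly_eqI) (simp add: coeff_map_poly)
  then have *: "image_mset cnj (eigenvalues A) = eigenvalues A"
    using of_real_hom.char_poly_hom[OF assms] proots_map_poly_cnj unfolding eigenvalues_def by metis
  have "cnj (\<Sum>\<beta>\<in>#M. \<beta> ^ k) = (\<Sum>\<beta>\<in>#image_mset cnj M. \<beta> ^ k)" for M
    by (induction M) auto
  from this[of "eigenvalues A"] have "cnj (\<Sum>\<beta>\<in>#eigenvalues A. \<beta> ^ k) = (\<Sum>\<beta>\<in>#eigenvalues A. \<beta> ^ k)"
    unfolding * .
  then show ?thesis unfolding Tr_def by (simp add: complex_eq_iff)
qed

end

theory Submission
  imports
    Defs
    "HOL-Analysis.Function_Topology"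
    "Jordan_Normal_Form.Schur_Decomposition"
begin

text \<open>
  A matrix in \<open>S_mats n\<close> is conjugate, by a diagonal matrix, to a real symmetric matrix \<open>b\<close>; a matrix
  in \<open>T_mats n\<close> is symmetric already. In both cases the squares \<open>b\<^sub>i\<^sub>j\<^sup>2\<close> are integers and the
  associated quadratic form is positive definite. Moreover, except possibly in \<open>T_mats n\<close> with \<open>n \<le> 2\<close>,
  \<open>b\<close> becomes rational after conjugation by a diagonal matrix; for \<open>T_mats n\<close> with \<open>n \<ge> 3\<close> the
  cycle condition gives this. Let \<open>d\<^sub>i = \<Sum>\<^sub>j b\<^sub>i\<^sub>j\<^sup>2\<close> be the diagonal entries of \<open>b\<^sup>2\<close>. A diagonal entry of the square of a symmetric
  matrix is at least the square of the diagonal entry, so \<open>Tr (2 ^ k) b \<ge> \<Sum>\<^sub>i d\<^sub>i ^ 2 ^ (k - 1)\<close>.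

  Everything then rests on one inequality: for \<open>n \<ge> 2\<close> there is an \<open>i\<close> with \<open>d\<^sub>i \<ge> 2\<close> such that the
  remaining \<open>d\<^sub>j\<close> add up to at least \<open>6 (n - 1) - 1\<close> (\<open>row_deletion_bound\<close>). The function
  \<open>x \<mapsto> x ^ m\<close> lies, at the natural numbers, on or above its secant through \<open>5\<close> and \<open>6\<close>; summing the secant
  over the \<open>n - 1\<close> rows other than \<open>i\<close> gives \<open>(n - 2) 6 ^ m + 5 ^ m\<close>, and row \<open>i\<close> contributes
  \<open>2 ^ m\<close>. The case \<open>m = 1\<close> is the bound on \<open>Tr 2\<close>.

  The inequality is about the diagonal entries and the edges of the graph of nonzero entries. If all
  diagonal entries are at least \<open>2\<close>, connectedness of the graph (at least \<open>n - 1\<close> edges) is enough.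
  If some \<open>b\<^sub>i\<^sub>i = 1\<close>, the Schur complement of that entry is again a form of the same kind on the
  other indices, and its trace is \<open>\<Sum>\<^sub>j\<^sub>\<noteq>\<^sub>i b\<^sub>j\<^sub>j\<close> minus the weight of the edges at \<open>i\<close>. Induction
  along Schur complements shows that the trace of a form with \<open>c\<close> connected components is at least
  \<open>2 n - c\<close> (\<open>trace_bound\<close>); combined with \<open>t\<^sup>2 \<ge> 3 t - 2\<close> for integers \<open>t\<close> and with the count of
  the edges that survive the deletion of \<open>i\<close>, this gives the inequality. The point that makes the
  constants fit is that the graph without \<open>i\<close> and the graph of the Schur complement cannot both be
  disconnected.

  For \<open>T_mats 2\<close> the cycle condition is empty and the diagonal may be irrational. Only five diagonals,
  up to order, violate the inequality, and for these an explicit conjugate of an eigenvalue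
  fails to be positive (\<open>small_diagonal_not_positive_definite\<close>).
\<close>

section \<open>Forms that a diagonal change of basis makes rational\<close>

lemma Ints_if_Rats_square_Ints:
  fixes x :: real
  assumes "x \<in> \<rat>" "x\<^sup>2 \<in> \<int>"
  shows "x \<in> \<int>"
proof (rule rational_algebraic_int_is_int[OF _ assms(1)])
  show "algebraic_int x"
  proof (rule algebraic_int_root[of "x\<^sup>2" "monom 1 2"])
    show "algebraic_int (x\<^sup>2)" using assms(2) by (simp add: int_imp_algebraic_int)
  qed (auto simp: poly_monom degree_monom_eq)
qed

lemma Ints_pos_ge_1: "x \<in> \<int> \<Longrightarrow> 0 < x \<Longrightarrow> 1 \<le> (x::real)"
  by (auto elim!: Ints_cases)

lemma square_ge_1: "x\<^sup>2 \<in> \<int> \<Longrightarrow> x \<noteq> 0 \<Longrightarrow> 1 \<le> (x::real)\<^sup>2"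
  by (rule Ints_pos_ge_1) auto

definition pos_def_form :: "'v set \<Rightarrow> ('v \<Rightarrow> 'v \<Rightarrow> real) \<Rightarrow> bool" where
  "pos_def_form V b \<longleftrightarrow>
     (\<forall>x. (\<exists>i\<in>V. x i \<noteq> 0) \<longrightarrow> 0 < (\<Sum>i\<in>V. \<Sum>j\<in>V. b i j * x i * x j))"

text \<open>The weights \<open>d\<close> are the diagonal matrix that makes \<open>b\<close> rational. They stand in for a condition on
  the products of \<open>b\<close> around cycles, and have the advantage over it that the same \<open>d\<close> serves for
  every Schur complement of \<open>b\<close>.\<close>

definition rational_form :: "'v set \<Rightarrow> ('v \<Rightarrow> 'v \<Rightarrow> real) \<Rightarrow> ('v \<Rightarrow> real) \<Rightarrow> bool" where
  "rational_form V b d \<longleftrightarrow> finite V \<and> pos_def_form V b \<and> (\<forall>i\<in>V. d i \<noteq> 0) \<and>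
     (\<forall>i\<in>V. \<forall>j\<in>V. b i j = b j i \<and> (b i j)\<^sup>2 \<in> \<int> \<and> d i * b i j / d j \<in> \<rat>)"

lemma rational_formD:
  assumes "rational_form V b d" "i \<in> V" "j \<in> V"
  shows "b i j = b j i" "(b i j)\<^sup>2 \<in> \<int>" "d i * b i j / d j \<in> \<rat>" "d i \<noteq> 0"
  using assms unfolding rational_form_def by blast+

lemma rational_form_pos:
  assumes "rational_form V b d" "i \<in> V" "x i \<noteq> 0"
  shows "0 < (\<Sum>i\<in>V. \<Sum>j\<in>V. b i j * x i * x j)"
proof -
  have "pos_def_form V b" using assms(1) unfolding rational_form_def by (elim conjE)
  then have "(\<exists>i\<in>V. x i \<noteq> 0) \<longrightarrow> 0 < (\<Sum>i\<in>V. \<Sum>j\<in>V. b i j * x i * x j)"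
    unfolding pos_def_form_def by (rule spec)
  then show ?thesis using assms(2,3) by blast
qed

lemma triangle_Ints:
  assumes f: "rational_form V b d" and V: "i \<in> V" "j \<in> V" "k \<in> V"
  shows "b j k * b i j * b i k \<in> \<int>"
proof (rule Ints_if_Rats_square_Ints)
  have d: "d i \<noteq> 0" "d j \<noteq> 0" "d k \<noteq> 0"
    using V rational_formD(4)[OF f] by blast+
  have "(d j * b j k / d k) * (d k * b k i / d i) * (d i * b i j / d j) \<in> \<rat>"
    by (intro Rats_mult rational_formD(3)[OF f] V)
  also have "(d j * b j k / d k) * (d k * b k i / d i) * (d i * b i j / d j) = b j k * b i j * b k i"
    using d by simp
  also have "b k i = b i k" by (rule rational_formD(1)[OF f V(3,1)])
  finally show "b j k * b i j * b i k \<in> \<rat>" .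
  show "(b j k * b i j * b i k)\<^sup>2 \<in> \<int>"
    unfolding power_mult_distrib by (intro Ints_mult rational_formD(2)[OF f] V)
qed

lemma diag_Ints:
  assumes f: "rational_form V b d" and i: "i \<in> V"
  shows "b i i \<in> \<int>"
  proof (rule Ints_if_Rats_square_Ints[OF _ rational_formD(2)[OF f i i]])
  show "b i i \<in> \<rat>" using rational_formD(3)[OF f i i] rational_formD(4)[OF f i i] by simp
qed

lemma diag_ge_1:
  assumes f: "rational_form V b d" and i: "i \<in> V"
  shows "1 \<le> b i i"
proof (rule Ints_pos_ge_1[OF diag_Ints[OF f i]])
  have fin: "finite V" using f by (simp add: rational_form_def)
  define x where "x = (\<lambda>j. if j = i then 1 else 0 :: real)"
  have "x i \<noteq> 0" by (simp add: x_def)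
  then have "0 < (\<Sum>k\<in>V. \<Sum>j\<in>V. b k j * x k * x j)"
    by (rule rational_form_pos[OF f i, where x = x])
  also have "\<dots> = b i i"
  proof -
    have "(\<Sum>j\<in>V. b k j * x k * x j) = (if k = i then b i i else 0)" for k
    proof -
      have "(\<Sum>j\<in>V. b k j * x k * x j) = (\<Sum>j\<in>V. if j = i then b k i * x k else 0)"
        by (intro sum.cong) (auto simp: x_def)
      also have "\<dots> = b k i * x k" using fin i by simp
      finally show ?thesis by (simp add: x_def)
    qed
    then show ?thesis using fin i by simp
  qed
  finally show "0 < b i i" .
qed

definition schur :: "'v \<Rightarrow> ('v \<Rightarrow> 'v \<Rightarrow> real) \<Rightarrow> 'v \<Rightarrow> 'v \<Rightarrow> real" where
  "schur i b j k = b j k - b i j * b i k"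

text \<open>Positivity: a vector on \<open>V - {i}\<close> extends to \<open>V\<close> by the value at \<open>i\<close> that minimizes the form, and
  the minimum is the value of the Schur complement. Integrality of the squares: the
  cross term of \<open>(b\<^sub>j\<^sub>k - b\<^sub>i\<^sub>j b\<^sub>i\<^sub>k)\<^sup>2\<close> is twice the product of \<open>b\<close> around the triangle \<open>i, j, k\<close>.\<close>

lemma rational_form_schur:
  assumes f: "rational_form V b d" and i: "i \<in> V" and 1: "b i i = 1"
  shows "rational_form (V - {i}) (schur i b) d"
proof -
  have fin: "finite V" and d0: "\<forall>i\<in>V. d i \<noteq> 0" using f by (auto simp: rational_form_def)
  have "pos_def_form (V - {i}) (schur i b)"
    unfolding pos_def_form_def
  proof (intro allI impI)
    fix x :: "'a \<Rightarrow> real"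
    assume ex: "\<exists>j\<in>V - {i}. x j \<noteq> 0"
    define W where "W = V - {i}"
    define L where "L = (\<Sum>j\<in>W. b i j * x j)"
    define y where "y = x(i := - L)"
    have W: "finite W" "i \<notin> W" "V = insert i W" using fin i by (auto simp: W_def)
    have yW: "\<And>j. j \<in> W \<Longrightarrow> y j = x j" using W by (auto simp: y_def)
    have yi: "y i = - L" by (simp add: y_def)
    have "0 < (\<Sum>j\<in>V. \<Sum>k\<in>V. b j k * y j * y k)"
    proof -
      obtain j where j: "j \<in> V - {i}" "x j \<noteq> 0" using ex by blast
      then have "j \<in> V" "y j \<noteq> 0" by (auto simp: y_def)
      then show ?thesis by (rule rational_form_pos[OF f, where x = y])
    qed
    also have "\<dots> = L\<^sup>2 + (\<Sum>k\<in>W. b i k * (- L) * x k) + (\<Sum>j\<in>W. b j i * x j * (- L)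
        + (\<Sum>k\<in>W. b j k * x j * x k))"
      using W 1 yW yi by (simp add: sum.insert power2_eq_square)
    also have "\<dots> = (\<Sum>j\<in>W. \<Sum>k\<in>W. b j k * x j * x k) - L\<^sup>2"
    proof -
      have "(\<Sum>j\<in>W. b j i * x j * (- L)) = - L * L"
        unfolding L_def sum_distrib_left
        using rational_formD(1)[OF f _ i] W by (intro sum.cong) (auto simp: mult_ac)
      moreover have "(\<Sum>k\<in>W. b i k * (- L) * x k) = - L * L"
        by (simp add: L_def sum_distrib_left mult_ac sum_negf)
      ultimately show ?thesis by (simp only: sum.distrib) (simp add: power2_eq_square)
    qed
    also have "L\<^sup>2 = (\<Sum>j\<in>W. \<Sum>k\<in>W. b i j * b i k * x j * x k)"
      unfolding L_def power2_eq_square sum_product by (simp add: mult_ac)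
    finally show "0 < (\<Sum>j\<in>V - {i}. \<Sum>k\<in>V - {i}. schur i b j k * x j * x k)"
      by (simp add: schur_def algebra_simps sum_subtractf flip: W_def)
  qed
  moreover have "schur i b j k = schur i b k j \<and> (schur i b j k)\<^sup>2 \<in> \<int> \<and>
      d j * schur i b j k / d k \<in> \<rat>" if jk: "j \<in> V" "k \<in> V" for j k
  proof (intro conjI)
    show "schur i b j k = schur i b k j" using rational_formD(1)[OF f jk] by (simp add: schur_def)
    have "(schur i b j k)\<^sup>2 = (b j k)\<^sup>2 - 2 * (b j k * b i j * b i k) + (b i j)\<^sup>2 * (b i k)\<^sup>2"
      by (simp add: schur_def power2_eq_square algebra_simps)
    also have "\<dots> \<in> \<int>"
      by (intro Ints_add Ints_diff Ints_mult rational_formD(2)[OF f] triangle_Ints[OF f i] jk i) simp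
    finally show "(schur i b j k)\<^sup>2 \<in> \<int>" .
    have di: "d i \<noteq> 0" using d0 i by blast
    have "d j * schur i b j k / d k = d j * b j k / d k - (d j * b j i / d i) * (d i * b i k / d k)"
      unfolding schur_def rational_formD(1)[OF f i jk(1)] using di
      by (simp add: diff_divide_distrib right_diff_distrib)
    also have "\<dots> \<in> \<rat>" by (intro Rats_diff Rats_mult rational_formD(3)[OF f] jk i)
    finally show "d j * schur i b j k / d k \<in> \<rat>" .
  qed
  ultimately show ?thesis using fin d0 by (simp add: rational_form_def)
qed

section \<open>Trace and edge counts\<close>

text \<open>Components are never named: that \<open>X\<close> meets every component of the graph of nonzero entries on \<open>V\<close>
  is expressed by saying that \<open>V\<close> is the only edge-closed set containing \<open>X\<close>, and \<open>card X\<close> then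
  plays the role of the number of components in all estimates.\<close>

definition closed_in :: "'v set \<Rightarrow> ('v \<Rightarrow> 'v \<Rightarrow> real) \<Rightarrow> 'v set \<Rightarrow> bool" where
  "closed_in V b R \<longleftrightarrow> R \<subseteq> V \<and> (\<forall>j\<in>R. \<forall>k\<in>V. b j k \<noteq> 0 \<longrightarrow> k \<in> R)"

definition covers :: "'v set \<Rightarrow> ('v \<Rightarrow> 'v \<Rightarrow> real) \<Rightarrow> 'v set \<Rightarrow> bool" where
  "covers V b X \<longleftrightarrow> X \<subseteq> V \<and> (\<forall>R. closed_in V b R \<longrightarrow> X \<subseteq> R \<longrightarrow> R = V)"

lemma covers_insert:
  assumes "covers V b X" "k \<in> V"
  shows "covers V b (insert k X)"
  using assms by (auto simp: covers_def)

definition nbrs :: "'v set \<Rightarrow> ('v \<Rightarrow> 'v \<Rightarrow> real) \<Rightarrow> 'v \<Rightarrow> 'v set" where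
  "nbrs V b i = {j \<in> V - {i}. b i j \<noteq> 0}"

text \<open>Stated with a closure condition that ignores the neighbours of \<open>i\<close>, so that it applies both to \<open>b\<close>
  and to its Schur complement: the two can only differ at pairs of neighbours of \<open>i\<close>, and those are
  all in \<open>R\<close> anyway.\<close>

lemma delete_vertex_closed:
  assumes c: "covers V b X" and i: "i \<in> V" and X: "X - {i} \<subseteq> R" and R: "R \<subseteq> V - {i}"
    and N: "nbrs V b i \<subseteq> R"
    and cl: "\<And>j k. j \<in> R \<Longrightarrow> k \<in> V - {i} \<Longrightarrow> k \<notin> nbrs V b i \<Longrightarrow> b j k \<noteq> 0 \<Longrightarrow> k \<in> R"
  shows "R = V - {i}"
proof -
  have "closed_in V b (insert i R)"
    unfolding closed_in_def
  proof (intro conjI ballI impI)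
    show "insert i R \<subseteq> V" using R i by auto
    fix j k assume "j \<in> insert i R" "k \<in> V" "b j k \<noteq> 0"
    then show "k \<in> insert i R" using cl[of j k] N by (auto simp: nbrs_def)
  qed
  then have "insert i R = V" using c X unfolding covers_def by blast
  then show ?thesis using R by auto
qed

lemma schur_nonnbr: "k \<in> V - {i} \<Longrightarrow> k \<notin> nbrs V b i \<Longrightarrow> schur i b j k = b j k"
  by (auto simp: schur_def nbrs_def)

lemma sum_nbrs:
  assumes "finite V" and "\<And>j. j \<in> V \<Longrightarrow> (b i j)\<^sup>2 \<in> \<int>"
  shows "real (card (nbrs V b i)) \<le> (\<Sum>j\<in>V - {i}. (b i j)\<^sup>2)"
proof -
  have "real (card (nbrs V b i)) = (\<Sum>j\<in>nbrs V b i. 1)" by simp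
  also have "\<dots> \<le> (\<Sum>j\<in>nbrs V b i. (b i j)\<^sup>2)"
    using assms(2) by (intro sum_mono square_ge_1) (auto simp: nbrs_def)
  also have "\<dots> \<le> (\<Sum>j\<in>V - {i}. (b i j)\<^sup>2)"
    using assms(1) by (intro sum_mono2) (auto simp: nbrs_def)
  finally show ?thesis .
qed

lemma covers_delete:
  assumes c: "covers V b X" and i: "i \<in> V" and X: "X \<subseteq> V"
  shows "covers (V - {i}) b (X - {i} \<union> nbrs V b i)"
    and "covers (V - {i}) (schur i b) (X - {i} \<union> nbrs V b i)"
proof -
  have "R = V - {i}" if "closed_in (V - {i}) b R" "X - {i} \<union> nbrs V b i \<subseteq> R" for R
    using that by (intro delete_vertex_closed[OF c i]) (auto simp: closed_in_def)
  then show "covers (V - {i}) b (X - {i} \<union> nbrs V b i)"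
    using X by (auto simp: covers_def nbrs_def)
  have "R = V - {i}" if R: "closed_in (V - {i}) (schur i b) R" "X - {i} \<union> nbrs V b i \<subseteq> R" for R
  proof (intro delete_vertex_closed[OF c i])
    fix j k assume "j \<in> R" "k \<in> V - {i}" "k \<notin> nbrs V b i" "b j k \<noteq> 0"
    with R(1) schur_nonnbr[of k V i b j] show "k \<in> R" by (simp add: closed_in_def)
  qed (use R in \<open>auto simp: closed_in_def\<close>)
  then show "covers (V - {i}) (schur i b) (X - {i} \<union> nbrs V b i)"
    using X by (auto simp: covers_def nbrs_def)
qed

text \<open>This pays for one step of the induction in \<open>trace_bound\<close>. If \<open>i\<close> is in \<open>X\<close>, replacing it by its
  neighbours suffices. Otherwise \<open>X\<close> reaches \<open>i\<close> through a first neighbour \<open>n0\<close>; no edge before \<open>n0\<close>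
  joins two neighbours of \<open>i\<close>, so \<open>n0\<close> is still reached in the Schur complement and only the other
  neighbours have to be added.\<close>

lemma covers_schur_small:
  assumes sym: "\<And>j k. j \<in> V \<Longrightarrow> k \<in> V \<Longrightarrow> b j k = b k j"
    and c: "covers V b X" and i: "i \<in> V" and fin: "finite V"
  obtains X' where "covers (V - {i}) (schur i b) X'"
    "card X' + 1 \<le> card X + card (nbrs V b i)"
proof (cases "i \<in> X")
  case True
  have X: "X \<subseteq> V" "finite X" using c fin by (auto simp: covers_def intro: finite_subset)
  have "card (X - {i} \<union> nbrs V b i) \<le> card (X - {i}) + card (nbrs V b i)" by (rule card_Un_le)
  moreover have "card (X - {i}) + 1 = card X"
    using True X card_Suc_Diff1[of X i] by simp
  ultimately show ?thesis using that[OF covers_delete(2)[OF c i X(1)]] by simp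
next
  case False
  have X: "X \<subseteq> V" "finite X" using c fin by (auto simp: covers_def intro: finite_subset)
  define N where "N = nbrs V b i"
  have finN: "finite N" using fin by (simp add: N_def nbrs_def)
  \<comment> \<open>the part reached from \<open>X\<close> in the Schur complement\<close>
  define R0 where "R0 = \<Inter>{R. closed_in (V - {i}) (schur i b) R \<and> X \<subseteq> R}"
  have top: "closed_in (V - {i}) (schur i b) (V - {i}) \<and> X \<subseteq> V - {i}"
    using X False by (auto simp: closed_in_def)
  have R0: "closed_in (V - {i}) (schur i b) R0" "X \<subseteq> R0"
    using top unfolding R0_def closed_in_def by blast+
  have "R0 \<inter> N \<noteq> {}"
  proof
    assume e: "R0 \<inter> N = {}"
    have "closed_in V b R0"
      unfolding closed_in_def
    proof (intro conjI ballI impI)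
      show sub: "R0 \<subseteq> V" using R0 by (auto simp: closed_in_def)
      fix j k assume jk: "j \<in> R0" "k \<in> V" "b j k \<noteq> 0"
      have j: "j \<in> V - {i}" "j \<notin> N" using jk R0 e by (auto simp: closed_in_def)
      then have "b i j = 0" by (auto simp: N_def nbrs_def)
      moreover from this have "k \<noteq> i" using sym[of j i] j jk i by auto
      ultimately show "k \<in> R0" using R0(1) jk by (auto simp: closed_in_def schur_def)
    qed
    then have "R0 = V" using c R0(2) by (auto simp: covers_def)
    then show False using R0(1) i by (auto simp: closed_in_def)
  qed
  then obtain n0 where n0: "n0 \<in> R0" "n0 \<in> N" by blast
  have "covers (V - {i}) (schur i b) (X \<union> (N - {n0}))"
    unfolding covers_def
  proof (intro conjI allI impI)
    show "X \<union> (N - {n0}) \<subseteq> V - {i}" using X False by (auto simp: N_def nbrs_def)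
    fix R assume R: "closed_in (V - {i}) (schur i b) R" "X \<union> (N - {n0}) \<subseteq> R"
    then have "R0 \<subseteq> R" by (auto simp: R0_def)
    then have "X - {i} \<union> nbrs V b i \<subseteq> R" using R n0 unfolding N_def by blast
    then show "R = V - {i}" using covers_delete(2)[OF c i X(1)] R(1) by (auto simp: covers_def)
  qed
  moreover have "card (X \<union> (N - {n0})) + 1 \<le> card X + card N"
  proof -
    have "card (X \<union> (N - {n0})) \<le> card X + card (N - {n0})" by (rule card_Un_le)
    moreover have "card (N - {n0}) + 1 = card N" using n0 finN card_Suc_Diff1[of N n0] by simp
    ultimately show ?thesis by simp
  qed
  ultimately show ?thesis using that unfolding N_def by blast
qed

text \<open>If no diagonal entry is \<open>1\<close>, all are at least \<open>2\<close>. Otherwise the Schur complement of a diagonal entry \<open>1\<close>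
  lowers the trace by \<open>1\<close> plus the weight of the edges at \<open>i\<close>, and that weight is at least the
  number of neighbours, which bounds the growth of the covering set.\<close>

lemma trace_bound:
  assumes "rational_form V b d" and "covers V b X"
  shows "2 * real (card V) - real (card X) \<le> (\<Sum>i\<in>V. b i i)"
  using assms
proof (induction "card V" arbitrary: V b X rule: less_induct)
  case less
  note f = less.prems(1) and c = less.prems(2)
  have fin: "finite V" using f by (simp add: rational_form_def)
  show ?case
  proof (cases "\<exists>i\<in>V. b i i = 1")
    case False
    have "2 \<le> b i i" if "i \<in> V" for i
    proof -
      have "b i i \<in> \<int>" "1 \<le> b i i" "b i i \<noteq> 1"
        using False diag_Ints[OF f that] diag_ge_1[OF f that] that by auto
      then show ?thesis by (auto elim!: Ints_cases)
    qed
    then have "(\<Sum>i\<in>V. 2) \<le> (\<Sum>i\<in>V. b i i)" by (intro sum_mono)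
    then show ?thesis by simp
  next
    case True
    then obtain i where i: "i \<in> V" "b i i = 1" by blast
    obtain X' where X': "covers (V - {i}) (schur i b) X'"
      "card X' + 1 \<le> card X + card (nbrs V b i)"
      using covers_schur_small[OF _ c i(1) fin] rational_formD(1)[OF f] by metis
    have card: "card V = card (V - {i}) + 1" using fin i card_Suc_Diff1[of V i] by simp
    have "2 * real (card (V - {i})) - real (card X') \<le> (\<Sum>j\<in>V - {i}. schur i b j j)"
      using less.hyps[OF _ rational_form_schur[OF f i] X'(1)] card by simp
    also have "\<dots> = (\<Sum>j\<in>V - {i}. b j j) - (\<Sum>j\<in>V - {i}. (b i j)\<^sup>2)"
      by (simp add: schur_def sum_subtractf power2_eq_square)
    finally have "2 * real (card (V - {i})) - real (card X') + (\<Sum>j\<in>V - {i}. (b i j)\<^sup>2)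
        \<le> (\<Sum>j\<in>V - {i}. b j j)" by simp
    moreover have "real (card (nbrs V b i)) \<le> (\<Sum>j\<in>V - {i}. (b i j)\<^sup>2)"
      using sum_nbrs[OF fin] rational_formD(2)[OF f i(1)] by blast
    moreover have "(\<Sum>j\<in>V. b j j) = 1 + (\<Sum>j\<in>V - {i}. b j j)"
      using sum.remove[OF fin i(1), of "\<lambda>j. b j j"] i by simp
    moreover have "real (card X') + 1 \<le> real (card X) + real (card (nbrs V b i))"
      using X'(2) by linarith
    ultimately show ?thesis using card by linarith
  qed
qed

text \<open>A covering set can be enlarged to \<open>V\<close> one vertex at a time, each along a new edge. The sum counts
  every edge twice.\<close>

lemma edge_bound:
  assumes fin: "finite V" and sym: "\<And>j k. j \<in> V \<Longrightarrow> k \<in> V \<Longrightarrow> b j k = b k j"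
    and int: "\<And>j k. j \<in> V \<Longrightarrow> k \<in> V \<Longrightarrow> (b j k)\<^sup>2 \<in> \<int>"
    and c: "covers V b X"
  shows "2 * (real (card V) - real (card X)) \<le> (\<Sum>j\<in>V. \<Sum>k\<in>V - {j}. (b j k)\<^sup>2)"
proof -
  \<comment> \<open>ordered pairs that are not yet inside the enlarged set\<close>
  define P where "P X = {(j, k). j \<in> V \<and> k \<in> V \<and> j \<noteq> k \<and> \<not> (j \<in> X \<and> k \<in> X)}" for X
  have finP: "finite (P X)" for X
    proof (rule finite_subset)
    show "P X \<subseteq> V \<times> V" unfolding P_def by blast
    show "finite (V \<times> V)" using fin by simp
  qed
  let ?g = "\<lambda>p. (b (fst p) (snd p))\<^sup>2"
  have "2 * (real (card V) - real (card X)) \<le> (\<Sum>p\<in>P X. ?g p)" if "covers V b X" for X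
    using that
  proof (induction "card V - card X" arbitrary: X rule: less_induct)
    case less
    have sub: "X \<subseteq> V" "finite X" using less.prems fin by (auto simp: covers_def intro: finite_subset)
    show ?case
    proof (cases "X = V")
      case True
      then show ?thesis by (simp add: sum_nonneg)
    next
      case False
      then have "\<not> closed_in V b X" using less.prems by (auto simp: covers_def)
      then obtain j k where jk: "j \<in> X" "k \<in> V" "k \<notin> X" "b j k \<noteq> 0"
        using sub by (auto simp: closed_in_def)
      have ci: "card (insert k X) = card X + 1" using sub jk by simp
      have "card X < card V" using sub False fin by (simp add: psubset_card_mono psubset_eq)
      then have IH: "2 * (real (card V) - real (card (insert k X))) \<le> (\<Sum>p\<in>P (insert k X). ?g p)"
        using less.hyps[of "insert k X"] covers_insert[OF less.prems jk(2)] ci by simp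
      have "(\<Sum>p\<in>P (insert k X). ?g p) + 2 \<le> (\<Sum>p\<in>P (insert k X). ?g p) + (\<Sum>p\<in>{(j,k),(k,j)}. ?g p)"
      proof -
        have "1 \<le> (b j k)\<^sup>2" "1 \<le> (b k j)\<^sup>2"
          using square_ge_1[OF int[of j k]] square_ge_1[OF int[of k j]] sym[of j k] jk sub by auto
        moreover have "(j, k) \<noteq> (k, j)" using jk by auto
        ultimately show ?thesis by simp
      qed
      also have "\<dots> = (\<Sum>p\<in>P (insert k X) \<union> {(j,k),(k,j)}. ?g p)"
        proof (rule sum.union_disjoint[symmetric])
          show "P (insert k X) \<inter> {(j,k),(k,j)} = {}" using jk by (auto simp: P_def)
        qed (use finP in simp_all)
      also have "\<dots> \<le> (\<Sum>p\<in>P X. ?g p)"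
        by (rule sum_mono2[OF finP]) (use jk sub in \<open>auto simp: P_def\<close>)
      finally show ?thesis using IH ci by simp
    qed
  qed
  from this[OF c] have "2 * (real (card V) - real (card X)) \<le> (\<Sum>p\<in>P X. ?g p)" .
  also have "\<dots> \<le> (\<Sum>p\<in>(SIGMA j:V. V - {j}). ?g p)"
    by (rule sum_mono2) (use fin in \<open>auto simp: P_def\<close>)
  also have "\<dots> = (\<Sum>j\<in>V. \<Sum>k\<in>V - {j}. (b j k)\<^sup>2)"
    using fin by (subst sum.Sigma) (auto simp: split_def)
  finally show ?thesis .
qed

lemma integer_square_ge:
  fixes t :: real
  assumes "t \<in> \<int>"
  shows "3 * t - 2 \<le> t\<^sup>2"
proof -
  obtain z where z: "t = of_int z" using assms by (auto elim: Ints_cases)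
  have "0 \<le> (z - 1) * (z - 2)"
    by (cases "z \<le> 1") (simp_all add: mult_nonpos_nonpos)
  then have "0 \<le> real_of_int ((z - 1) * (z - 2))" by linarith
  then show ?thesis by (simp add: z power2_eq_square algebra_simps)
qed

text \<open>Let \<open>w\<close> be the weight of the edges at \<open>i\<close>, let \<open>X\<close> cover the Schur complement and let \<open>Y\<close> cover
  \<open>V - {i}\<close> with the original edges. Then \<open>trace_bound\<close> and \<open>edge_bound\<close> bound the sum from below by
  \<open>6 (card V - 1) + 4 w - 3 card X - 2 card Y\<close>, so \<open>3 card X + 2 card Y \<le> 4 w + 1\<close> is needed. The set
  of neighbours of \<open>i\<close> is a possible choice for both \<open>X\<close> and \<open>Y\<close>, and one of them can be
  replaced by a single neighbour \<open>j0\<close>: if \<open>j0\<close> does not cover the Schur complement, some neighbours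
  of \<open>i\<close> are not reached by it there, which means that they are joined by original edges to all
  neighbours that are reached, and then \<open>j0\<close> covers \<open>V - {i}\<close> with the original edges.\<close>

lemma row_deletion_bound_at_1:
  assumes f: "rational_form V b d" and c: "covers V b {i}" and i: "i \<in> V" "b i i = 1"
    and n2: "2 \<le> card V"
  shows "6 * real (card V) - 7 \<le> (\<Sum>j\<in>V - {i}. \<Sum>k\<in>V. (b j k)\<^sup>2)"
proof -
  define W where "W = V - {i}"
  define N where "N = nbrs V b i"
  define w where "w = (\<Sum>j\<in>W. (b i j)\<^sup>2)"
  have fin: "finite V" using f by (simp add: rational_form_def)
  have sym: "\<And>j k. j \<in> V \<Longrightarrow> k \<in> V \<Longrightarrow> b j k = b k j"
    and int: "\<And>j k. j \<in> V \<Longrightarrow> k \<in> V \<Longrightarrow> (b j k)\<^sup>2 \<in> \<int>"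
    using rational_formD[OF f] by blast+
  have card: "real (card V) = real (card W) + 1" using fin i card_Suc_Diff1[of V i] by (simp add: W_def)
  have Nw: "real (card N) \<le> w" using sum_nbrs[of V b i, OF fin int[OF i(1)]] by (simp add: w_def N_def W_def)
  have finN: "finite N" "N \<subseteq> W" using fin by (auto simp: N_def nbrs_def W_def)
  have "N \<noteq> {}"
  proof
    assume "N = {}"
    then have "closed_in V b {i}" using i by (auto simp: closed_in_def N_def nbrs_def)
    then have "{i} = V" using c by (auto simp: covers_def)
    then show False using n2 by (metis card_1_singleton_iff numeral_le_one_iff One_nat_def semiring_norm(69))
  qed
  then obtain j0 where j0: "j0 \<in> N" by blast
  have cN: "1 \<le> card N" using j0 finN by (simp add: Suc_le_eq card_gt_0_iff) blast
  have N1: "covers W b N" "covers W (schur i b) N"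
    using covers_delete[OF c i(1)] i by (simp_all add: W_def N_def)
  have "\<exists>X Y. covers W (schur i b) X \<and> covers W b Y \<and> 3 * card X + 2 * card Y \<le> 4 * card N + 1"
  proof (cases "covers W b {j0}")
    case True
    then show ?thesis using N1(2) cN by (intro exI[of _ N] exI[of _ "{j0}"]) simp
  next
    case False
    have "covers W (schur i b) {j0}"
      unfolding covers_def
    proof (intro conjI allI impI)
      show "{j0} \<subseteq> W" using j0 finN by auto
      fix R assume R: "closed_in W (schur i b) R" "{j0} \<subseteq> R"
      have RW: "R \<subseteq> W" using R(1) by (simp add: closed_in_def)
      have "N \<subseteq> R"
      proof (rule ccontr)
        assume "\<not> N \<subseteq> R"
        then obtain k0 where k0: "k0 \<in> N" "k0 \<notin> R" by blast
        have join: "b j k \<noteq> 0" "b k j \<noteq> 0" if "j \<in> N \<inter> R" "k \<in> N - R" for j k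
        proof -
          have jW: "j \<in> W" "k \<in> W" using that finN by auto
          have "schur i b j k = 0" using R(1) jW that by (auto simp: closed_in_def)
          moreover have "b i j \<noteq> 0" "b i k \<noteq> 0" using that by (auto simp: N_def nbrs_def)
          ultimately show "b j k \<noteq> 0" by (auto simp: schur_def)
          then show "b k j \<noteq> 0" using sym[of j k] jW by (auto simp: W_def)
        qed
        have "covers W b {j0}"
          unfolding covers_def
        proof (intro conjI allI impI)
          show "{j0} \<subseteq> W" using j0 finN by auto
          fix Q assume Q: "closed_in W b Q" "{j0} \<subseteq> Q"
          have 1: "k \<in> Q" if "k \<in> N - R" for k
            using Q join(1)[of j0 k] R(2) j0 that finN by (auto simp: closed_in_def)
          have 2: "k \<in> Q" if "k \<in> N \<inter> R" for k
            using Q(1) join(2)[of k k0] 1[of k0] k0 that finN by (auto simp: closed_in_def)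
          have "N \<subseteq> Q" using 1 2 by blast
          then show "Q = W" using N1(1) Q(1) by (auto simp: covers_def)
        qed
        then show False using False by simp
      qed
      then show "R = W" using N1(2) R(1) by (auto simp: covers_def)
    qed
    then show ?thesis using N1(1) cN by (intro exI[of _ "{j0}"] exI[of _ N]) simp
  qed
  then obtain X Y where XY: "covers W (schur i b) X" "covers W b Y"
    "3 * card X + 2 * card Y \<le> 4 * card N + 1" by blast
  have "2 * real (card W) - real (card X) \<le> (\<Sum>j\<in>W. schur i b j j)"
    using trace_bound[OF rational_form_schur[OF f i]] XY(1) by (simp add: W_def)
  also have "\<dots> = (\<Sum>j\<in>W. b j j) - w"
    by (simp add: schur_def sum_subtractf power2_eq_square w_def)
  finally have tr: "2 * real (card W) - real (card X) + w \<le> (\<Sum>j\<in>W. b j j)" by simp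
  have "3 * (\<Sum>j\<in>W. b j j) - 2 * real (card W) = (\<Sum>j\<in>W. 3 * b j j - 2)"
    by (simp add: sum_subtractf sum_distrib_left)
  also have "\<dots> \<le> (\<Sum>j\<in>W. (b j j)\<^sup>2)"
    by (intro sum_mono integer_square_ge diag_Ints[OF f]) (auto simp: W_def)
  finally have sq: "3 * (\<Sum>j\<in>W. b j j) - 2 * real (card W) \<le> (\<Sum>j\<in>W. (b j j)\<^sup>2)" .
  have ed: "2 * (real (card W) - real (card Y)) \<le> (\<Sum>j\<in>W. \<Sum>k\<in>W - {j}. (b j k)\<^sup>2)"
    by (rule edge_bound) (use fin sym int XY in \<open>auto simp: W_def\<close>)
  have "(\<Sum>j\<in>W. \<Sum>k\<in>V. (b j k)\<^sup>2)
      = (\<Sum>j\<in>W. (b j j)\<^sup>2 + ((b i j)\<^sup>2 + (\<Sum>k\<in>W - {j}. (b j k)\<^sup>2)))"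
  proof (rule sum.cong[OF refl])
    fix j assume j: "j \<in> W"
    have "(\<Sum>k\<in>V. (b j k)\<^sup>2) = (b j i)\<^sup>2 + (\<Sum>k\<in>W. (b j k)\<^sup>2)"
      using sum.remove[OF fin i(1), of "\<lambda>k. (b j k)\<^sup>2"] by (simp add: W_def)
    also have "(\<Sum>k\<in>W. (b j k)\<^sup>2) = (b j j)\<^sup>2 + (\<Sum>k\<in>W - {j}. (b j k)\<^sup>2)"
      using fin j by (intro sum.remove) (auto simp: W_def)
    also have "b j i = b i j" using sym j i by (auto simp: W_def)
    finally show "(\<Sum>k\<in>V. (b j k)\<^sup>2) = (b j j)\<^sup>2 + ((b i j)\<^sup>2 + (\<Sum>k\<in>W - {j}. (b j k)\<^sup>2))" by simp
  qed
  also have "\<dots> = (\<Sum>j\<in>W. (b j j)\<^sup>2) + (w + (\<Sum>j\<in>W. \<Sum>k\<in>W - {j}. (b j k)\<^sup>2))"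
    by (simp add: sum.distrib w_def)
  finally have eq: "(\<Sum>j\<in>W. \<Sum>k\<in>V. (b j k)\<^sup>2)
      = (\<Sum>j\<in>W. (b j j)\<^sup>2) + (w + (\<Sum>j\<in>W. \<Sum>k\<in>W - {j}. (b j k)\<^sup>2))" .
  have "real (3 * card X + 2 * card Y) \<le> real (4 * card N + 1)" using XY(3) by (rule of_nat_mono)
  then have XYr: "3 * real (card X) + 2 * real (card Y) \<le> 4 * real (card N) + 1" by simp
  have "6 * real (card V) - 7 \<le> (\<Sum>j\<in>W. \<Sum>k\<in>V. (b j k)\<^sup>2)"
    unfolding eq using tr sq ed XYr Nw card by argo
  then show ?thesis by (simp add: W_def)
qed

lemma row_deletion_bound:
  assumes f: "rational_form V b d" and c: "\<And>i. i \<in> V \<Longrightarrow> covers V b {i}"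
    and n2: "2 \<le> card V"
  shows "\<exists>i\<in>V. 2 \<le> (\<Sum>k\<in>V. (b i k)\<^sup>2) \<and>
     6 * real (card V) - 7 \<le> (\<Sum>j\<in>V - {i}. \<Sum>k\<in>V. (b j k)\<^sup>2)"
proof -
  let ?d = "\<lambda>j. \<Sum>k\<in>V. (b j k)\<^sup>2"
  have fin: "finite V" using f by (simp add: rational_form_def)
  have sym: "\<And>j k. j \<in> V \<Longrightarrow> k \<in> V \<Longrightarrow> b j k = b k j"
    and int: "\<And>j k. j \<in> V \<Longrightarrow> k \<in> V \<Longrightarrow> (b j k)\<^sup>2 \<in> \<int>"
    using rational_formD[OF f] by blast+
  have dsplit: "?d j = (b j j)\<^sup>2 + (\<Sum>k\<in>V - {j}. (b j k)\<^sup>2)" if "j \<in> V" for j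
    using sum.remove[OF fin that, of "\<lambda>k. (b j k)\<^sup>2"] by simp
  have w1: "1 \<le> (\<Sum>k\<in>V - {j}. (b j k)\<^sup>2)" if "j \<in> V" for j
  proof -
    have "nbrs V b j \<noteq> {}"
    proof
      assume "nbrs V b j = {}"
      then have "closed_in V b {j}" using that by (auto simp: closed_in_def nbrs_def)
      then have "{j} = V" using c[OF that] by (auto simp: covers_def)
      then show False using n2 by (metis card_1_singleton_iff numeral_le_one_iff One_nat_def semiring_norm(69))
    qed
    then have "1 \<le> card (nbrs V b j)" using fin by (simp add: Suc_le_eq card_gt_0_iff nbrs_def)
    then show ?thesis using sum_nbrs[of V b j, OF fin int[OF that]] by linarith
  qed
  have sq1: "1 \<le> (b j j)\<^sup>2" if "j \<in> V" for j
    using diag_ge_1[OF f that] by (simp add: one_le_power)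
  have d2: "2 \<le> ?d j" if "j \<in> V" for j
    using dsplit[OF that] w1[OF that] sq1[OF that] by linarith
  have V0: "V \<noteq> {}" using n2 by auto
  have cardj: "real (card (V - {j})) = real (card V) - 1" if "j \<in> V" for j
    using fin that n2 by (simp add: card_Diff_singleton of_nat_diff)
  \<comment> \<open>a row with norm below \<open>6\<close> has norm at most \<open>5\<close>, and omitting it from a total of at least
      \<open>6 card V - 2\<close> is enough\<close>
  consider (one) i where "i \<in> V" "b i i = 1" | (six) "\<forall>i\<in>V. 6 \<le> ?d i"
    | (five) i where "i \<in> V" "?d i < 6" "\<forall>j\<in>V. b j j \<noteq> 1" by force
  then show ?thesis
  proof cases
    case one
    then show ?thesis using row_deletion_bound_at_1[OF f c[OF one(1)] one n2] d2 by blast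
  next
    case six
    obtain i where i: "i \<in> V" using V0 by blast
    have "(\<Sum>j\<in>V - {i}. 6) \<le> (\<Sum>j\<in>V - {i}. ?d j)" using six by (intro sum_mono) auto
    then show ?thesis using d2[OF i] i cardj[OF i] by (intro bexI[of _ i]) auto
  next
    case five
    have t2: "4 \<le> (b j j)\<^sup>2" if "j \<in> V" for j
    proof -
      have "b j j \<in> \<int>" "1 \<le> b j j" "b j j \<noteq> 1"
        using diag_Ints[OF f that] diag_ge_1[OF f that] five(3) that by auto
      then have "2 \<le> b j j" by (auto elim!: Ints_cases)
      then show ?thesis using power_mono[of 2 "b j j" 2] by simp
    qed
    have "2 * (real (card V) - 1) \<le> (\<Sum>j\<in>V. \<Sum>k\<in>V - {j}. (b j k)\<^sup>2)"
      using edge_bound[OF fin sym int c[OF five(1)]] by simp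
    moreover have "4 * real (card V) \<le> (\<Sum>j\<in>V. (b j j)\<^sup>2)"
      using sum_mono[of V "\<lambda>_. 4" "\<lambda>j. (b j j)\<^sup>2", OF t2] by simp
    moreover have "(\<Sum>j\<in>V. ?d j) = (\<Sum>j\<in>V. (b j j)\<^sup>2) + (\<Sum>j\<in>V. \<Sum>k\<in>V - {j}. (b j k)\<^sup>2)"
      using dsplit by (simp add: sum.distrib)
    moreover have "(\<Sum>j\<in>V. ?d j) = ?d i + (\<Sum>j\<in>V - {i}. ?d j)"
      using sum.remove[OF fin five(1), of ?d] by simp
    moreover have "?d i \<le> 5"
    proof -
      have "?d i \<in> \<int>" using int five(1) by (intro Ints_sum) auto
      then obtain z where "?d i = of_int z" by (auto elim: Ints_cases)
      then show ?thesis using five(2) by simp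
    qed
    ultimately show ?thesis using d2[OF five(1)] five(1) by (intro bexI[of _ i]) auto
  qed
qed

section \<open>Positive eigenvalues give a positive definite form\<close>

lemma nonneg_quadratic_imp_linear_coeff_0:
  fixes p q :: real
  assumes "\<And>t. 0 \<le> 2 * t * p + t\<^sup>2 * q"
  shows "p = 0"
proof (rule ccontr)
  assume p: "p \<noteq> 0"
  \<comment> \<open>at \<open>t = - c * p\<close> the quadratic term is too small to make up for the linear one\<close>
  define c where "c = 1 / (\<bar>q\<bar> + 1)"
  have c: "c > 0" by (simp add: c_def)
  have "c * \<bar>q\<bar> < 1" by (simp add: c_def field_simps)
  moreover have "c * q \<le> c * \<bar>q\<bar>" using c by (intro mult_left_mono) auto
  ultimately have "c * q - 2 < 0" by linarith
  then have "c * p\<^sup>2 * (c * q - 2) < 0" using c p by (intro mult_pos_neg) auto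
  moreover have "2 * (- c * p) * p + (- c * p)\<^sup>2 * q = c * p\<^sup>2 * (c * q - 2)"
    by (simp add: power2_eq_square algebra_simps)
  ultimately show False using assms[of "- c * p"] by simp
qed

text \<open>The minimum of the form on the unit sphere is attained, and a minimizer is an eigenvector because
  the form minus \<open>\<mu>\<close> times the squared length is nonnegative and vanishes there. Vectors are functions
  that are zero outside \<open>V\<close>; the sphere is compact as a closed subset of a product of intervals.\<close>

lemma smallest_eigenpair:
  fixes b :: "'v \<Rightarrow> 'v \<Rightarrow> real"
  assumes fin: "finite V" and ne: "V \<noteq> {}" and sym: "\<And>i j. i \<in> V \<Longrightarrow> j \<in> V \<Longrightarrow> b i j = b j i"
  obtains \<mu> x where "\<exists>i\<in>V. x i \<noteq> 0" "\<And>i. i \<in> V \<Longrightarrow> (\<Sum>j\<in>V. b i j * x j) = \<mu> * x i"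
    "\<And>y. \<mu> * (\<Sum>i\<in>V. (y i)\<^sup>2) \<le> (\<Sum>i\<in>V. \<Sum>j\<in>V. b i j * y i * y j)"
proof -
  define Q where "Q = (\<lambda>x :: 'v \<Rightarrow> real. \<Sum>i\<in>V. \<Sum>j\<in>V. b i j * x i * x j)"
  define N where "N = (\<lambda>x :: 'v \<Rightarrow> real. \<Sum>i\<in>V. (x i)\<^sup>2)"
  have N_eq: "N x = (\<Sum>i\<in>V. (x i)\<^sup>2)" for x by (simp add: N_def)
  have Q_eq: "Q x = (\<Sum>i\<in>V. \<Sum>j\<in>V. b i j * x i * x j)" for x by (simp add: Q_def)
  define K where "K = (\<Pi>\<^sub>E i\<in>UNIV. if i \<in> V then {-1..1::real} else {0})"
  define S where "S = K \<inter> {x. N x = 1}"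
  have coord: "continuous_on UNIV (\<lambda>x :: 'v \<Rightarrow> real. x i)" for i
    by (rule continuous_on_product_coordinates)
  have contN: "continuous_on UNIV N" and contQ: "continuous_on UNIV Q"
    unfolding N_def Q_def by (intro continuous_intros coord)+
  have "compactin (product_topology (\<lambda>i. euclidean) UNIV) K"
    unfolding K_def compactin_PiE by (auto simp: compactin_euclidean_iff)
  then have "compact K"
    by (simp add: euclidean_product_topology compactin_euclidean_iff)
  moreover have "closed {x. N x = 1}"
    using closed_Collect_eq[OF contN continuous_on_const] by simp
  ultimately have "compact S" unfolding S_def by (rule compact_Int_closed)
  have in_S: "z \<in> S" if "N z = 1" "\<And>i. i \<notin> V \<Longrightarrow> z i = 0" for z
  proof -
    have "\<bar>z i\<bar> \<le> 1" if i: "i \<in> V" for i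
    proof -
      have "(z i)\<^sup>2 \<le> N z" unfolding N_def using fin i by (intro member_le_sum) auto
      then show ?thesis using \<open>N z = 1\<close> by (simp add: abs_square_le_1)
    qed
    then show ?thesis using that by (auto simp: S_def K_def abs_le_iff PiE_iff minus_le_iff)
  qed
  \<comment> \<open>zero outside \<open>V\<close>, as the points of \<open>S\<close> have to be\<close>
  define unitize where "unitize = (\<lambda>(y :: 'v \<Rightarrow> real) i. if i \<in> V then y i / sqrt (N y) else 0)"
  have pos: "0 < N y" if "\<exists>i\<in>V. y i \<noteq> 0" for y
  proof -
    from that obtain i where "i \<in> V" "y i \<noteq> 0" by blast
    then show ?thesis unfolding N_def using fin by (intro sum_pos2[of V i]) auto
  qed
  have norm_S: "unitize y \<in> S" if "0 < N y" for y
  proof (rule in_S)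
    have "N (unitize y) = (\<Sum>i\<in>V. (y i)\<^sup>2 / N y)"
      unfolding N_eq[of "unitize y"] using that
      by (intro sum.cong) (auto simp: unitize_def power_divide)
    also have "\<dots> = 1" using that by (simp add: N_def flip: sum_divide_distrib)
    finally show "N (unitize y) = 1" .
  qed (simp add: unitize_def)
  have norm_Q: "Q (unitize y) = Q y / N y" if "0 < N y" for y
  proof -
    have "Q (unitize y) = (\<Sum>i\<in>V. \<Sum>j\<in>V. b i j * y i * y j / N y)"
      unfolding Q_eq[of "unitize y"] using that
      by (intro sum.cong) (auto simp: unitize_def)
    then show ?thesis by (simp add: Q_def sum_divide_distrib)
  qed
  have "S \<noteq> {}"
  proof -
    obtain i where "i \<in> V" using ne by blast
    then have "0 < N (\<lambda>_. 1)" by (intro pos) auto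
    then show ?thesis using norm_S by blast
  qed
  from continuous_attains_inf[OF \<open>compact S\<close> this continuous_on_subset[OF contQ subset_UNIV]]
  obtain x where x: "x \<in> S" "\<And>y. y \<in> S \<Longrightarrow> Q x \<le> Q y" by blast
  define \<mu> where "\<mu> = Q x"
  have Nx: "N x = 1" using x(1) by (simp add: S_def)
  have bound: "\<mu> * N y \<le> Q y" for y
  proof (cases "\<exists>i\<in>V. y i \<noteq> 0")
    case True
    then have "0 < N y" by (rule pos)
    then show ?thesis using x(2)[OF norm_S] norm_Q by (simp add: \<mu>_def le_divide_eq)
  next
    case False
    then have "N y = 0" "Q y = 0" by (auto simp: N_def Q_def)
    then show ?thesis by simp
  qed
  show ?thesis
  proof
    show "\<exists>i\<in>V. x i \<noteq> 0"
    proof (rule ccontr)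
      assume "\<not> (\<exists>i\<in>V. x i \<noteq> 0)"
      then have "N x = 0" by (simp add: N_def)
      then show False using Nx by simp
    qed
    show "\<mu> * (\<Sum>i\<in>V. (y i)\<^sup>2) \<le> (\<Sum>i\<in>V. \<Sum>j\<in>V. b i j * y i * y j)" for y
      using bound[of y] by (simp add: N_def Q_def)
    fix i assume i: "i \<in> V"
    define L where "L = (\<Sum>j\<in>V. b i j * x j)"
    define e where "e = (\<lambda>j. if j = i then 1 else 0 :: real)"
    have e1: "(\<Sum>j\<in>V. f j * e j) = f i" for f
    proof -
      have "(\<Sum>j\<in>V. f j * e j) = (\<Sum>j\<in>V. if j = i then f i else 0)"
        by (intro sum.cong) (auto simp: e_def)
      then show ?thesis using fin i by simp
    qed
    have "L - \<mu> * x i = 0"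
    proof (rule nonneg_quadratic_imp_linear_coeff_0)
      fix t
      define y where "y = (\<lambda>j. x j + t * e j)"
      have "N y = (\<Sum>j\<in>V. (x j)\<^sup>2 + 2 * t * (x j * e j) + t\<^sup>2 * (e j * e j))"
        unfolding N_def y_def by (intro sum.cong) (auto simp: power2_eq_square algebra_simps)
      also have "\<dots> = N x + 2 * t * x i + t\<^sup>2"
        unfolding sum.distrib sum_distrib_left[symmetric] e1 by (simp add: N_def e_def)
      finally have Ny: "N y = 1 + 2 * t * x i + t\<^sup>2" using Nx by simp
      have "Q y = (\<Sum>k\<in>V. \<Sum>j\<in>V. b k j * x k * x j + t * (b k j * x k * e j)
          + t * (b k j * x j * e k) + t\<^sup>2 * (b k j * e j * e k))"
        unfolding Q_def y_def by (intro sum.cong) (auto simp: power2_eq_square algebra_simps)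
      also have "\<dots> = Q x + t * (\<Sum>k\<in>V. b k i * x k) + t * (\<Sum>k\<in>V. (\<Sum>j\<in>V. b k j * x j) * e k)
          + t\<^sup>2 * (\<Sum>k\<in>V. b k i * e k)"
        unfolding sum.distrib sum_distrib_left[symmetric] e1 sum_distrib_right[symmetric]
        by (simp add: Q_def)
      also have "(\<Sum>k\<in>V. b k i * x k) = L"
        unfolding L_def by (intro sum.cong arg_cong2[where f = "(*)"] sym i) auto
      also have "(\<Sum>k\<in>V. (\<Sum>j\<in>V. b k j * x j) * e k) = L"
        unfolding e1 L_def ..
      also have "(\<Sum>k\<in>V. b k i * e k) = b i i" unfolding e1 ..
      finally have "Q y = \<mu> + 2 * t * L + t\<^sup>2 * b i i" by (simp add: \<mu>_def)
      then show "0 \<le> 2 * t * (L - \<mu> * x i) + t\<^sup>2 * (b i i - \<mu>)"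
        using bound[of y] unfolding Ny by (simp add: algebra_simps)
    qed
    then show "(\<Sum>j\<in>V. b i j * x j) = \<mu> * x i" by (simp add: L_def)
  qed
qed

lemma in_eigenvalues_iff:
  assumes "A \<in> carrier_mat n n"
  shows "\<beta> \<in># eigenvalues A \<longleftrightarrow> poly (char_poly (map_mat complex_of_real A)) \<beta> = 0"
proof -
  have "char_poly (map_mat complex_of_real A) \<noteq> 0"
    using degree_monic_char_poly[of "map_mat complex_of_real A" n] assms by auto
  then show ?thesis by (simp add: eigenvalues_def)
qed

lemma real_eigenpair_in_eigenvalues:
  assumes A: "A \<in> carrier_mat n n" and "i < n" "x i \<noteq> 0"
    and x: "\<And>i. i < n \<Longrightarrow> (\<Sum>j<n. A $$ (i, j) * x j) = \<mu> * x i"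
  shows "complex_of_real \<mu> \<in># eigenvalues A"
proof -
  let ?v = "vec n x"
  have "eigenvector A ?v \<mu>"
    unfolding eigenvector_def
  proof (intro conjI)
    show "A *\<^sub>v ?v = \<mu> \<cdot>\<^sub>v ?v"
      using A x by (intro eq_vecI) (auto simp: scalar_prod_def lessThan_atLeast0)
    show "?v \<noteq> 0\<^sub>v (dim_row A)"
      using A assms(2,3) by (auto simp: vec_eq_iff)
  qed (use A in auto)
  then have "poly (char_poly A) \<mu> = 0"
    using eigenvalue_root_char_poly[OF A] by (auto simp: eigenvalue_def)
  moreover have "char_poly (map_mat complex_of_real A) = map_poly complex_of_real (char_poly A)"
    by (rule of_real_hom.char_poly_hom[OF A])
  ultimately show ?thesis by (simp add: in_eigenvalues_iff[OF A])
qed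

lemma pos_def_form_if_eigenvalues_pos:
  assumes A: "A \<in> carrier_mat n n" and sym: "symmetric_mat A"
    and pos: "\<And>\<beta>. \<beta> \<in># eigenvalues A \<Longrightarrow> 0 < Re \<beta>"
  shows "pos_def_form {..<n} (\<lambda>i j. A $$ (i, j))"
proof (cases "n = 0")
  case True
  then show ?thesis by (simp add: pos_def_form_def)
next
  case False
  have s: "A $$ (i, j) = A $$ (j, i)" if "i < n" "j < n" for i j
  proof -
    have "A $$ (i, j) = transpose_mat A $$ (i, j)" using sym by (simp add: symmetric_mat_def)
    then show ?thesis using A that by simp
  qed
  obtain \<mu> x where x: "\<exists>i\<in>{..<n}. x i \<noteq> 0"
    "\<And>i. i \<in> {..<n} \<Longrightarrow> (\<Sum>j<n. A $$ (i, j) * x j) = \<mu> * x i"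
    "\<And>y. \<mu> * (\<Sum>i<n. (y i)\<^sup>2) \<le> (\<Sum>i<n. \<Sum>j<n. A $$ (i, j) * y i * y j)"
    by (rule smallest_eigenpair[of "{..<n}" "\<lambda>i j. A $$ (i, j)"]) (use s False in auto)
  then obtain i where "i < n" "x i \<noteq> 0" by auto
  then have "complex_of_real \<mu> \<in># eigenvalues A"
    using x(2) by (intro real_eigenpair_in_eigenvalues[OF A, where x = x]) auto
  then have "\<mu> > 0" using pos by fastforce
  show ?thesis
    unfolding pos_def_form_def
  proof (intro allI impI)
    fix y :: "nat \<Rightarrow> real" assume "\<exists>i\<in>{..<n}. y i \<noteq> 0"
    then obtain i where "i < n" "y i \<noteq> 0" by blast
    then have "0 < (\<Sum>i<n. (y i)\<^sup>2)" by (intro sum_pos2[of "{..<n}" i]) auto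
    with \<open>\<mu> > 0\<close> have "0 < \<mu> * (\<Sum>i<n. (y i)\<^sup>2)" by simp
    also note x(3)[of y]
    finally show "0 < (\<Sum>i<n. \<Sum>j<n. A $$ (i, j) * y i * y j)" .
  qed
qed

section \<open>Power sums of eigenvalues and diagonals of powers\<close>

definition trace :: "'a :: comm_ring_1 mat \<Rightarrow> 'a" where
  "trace A = (\<Sum>i<dim_row A. A $$ (i, i))"

lemma trace_mult_commute:
  assumes "A \<in> carrier_mat n n" "B \<in> carrier_mat n n"
  shows "trace (A * B) = trace (B * A)"
proof -
  have "trace (A * B) = (\<Sum>i<n. \<Sum>j<n. A $$ (i, j) * B $$ (j, i))"
    using assms by (simp add: trace_def scalar_prod_def lessThan_atLeast0)
  also have "\<dots> = (\<Sum>j<n. \<Sum>i<n. B $$ (j, i) * A $$ (i, j))"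
    by (subst sum.swap) (simp add: mult.commute)
  also have "\<dots> = trace (B * A)"
    using assms by (simp add: trace_def scalar_prod_def lessThan_atLeast0)
  finally show ?thesis .
qed

lemma trace_similar:
  assumes "similar_mat_wit A B P Q"
  shows "trace A = trace B"
proof -
  note w = similar_mat_witD[OF refl assms]
  have "P * B * Q = P * (B * Q)" by (rule assoc_mult_mat[OF w(6,5,7)])
  with w(3) have "A = P * (B * Q)" by (rule trans)
  then have "trace A = trace (P * (B * Q))" by (rule arg_cong)
  also have "\<dots> = trace (B * Q * P)"
    by (rule trace_mult_commute[OF w(6) mult_carrier_mat[OF w(5,7)]])
  also have "B * Q * P = B * (Q * P)" by (rule assoc_mult_mat[OF w(5,7,6)])
  also have "\<dots> = B" unfolding w(2) by (rule right_mult_one_mat[OF w(5)])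
  finally show ?thesis .
qed

lemma upper_triangular_pow:
  fixes B :: "'a :: comm_ring_1 mat"
  assumes B: "B \<in> carrier_mat n n" and ut: "upper_triangular B"
  shows "upper_triangular (B ^\<^sub>m k) \<and> (\<forall>i<n. (B ^\<^sub>m k) $$ (i, i) = B $$ (i, i) ^ k)"
proof (induction k)
  case 0
  then show ?case using B by (auto simp: upper_triangular_def)
next
  case (Suc k)
  have C: "B ^\<^sub>m k \<in> carrier_mat n n" using B by simp
  have entry: "(B ^\<^sub>m k * B) $$ (i, j) = (\<Sum>l<n. (B ^\<^sub>m k) $$ (i, l) * B $$ (l, j))"
    if "i < n" "j < n" for i j
    using that B C by (simp add: scalar_prod_def lessThan_atLeast0)
  have z: "(B ^\<^sub>m k) $$ (i, l) * B $$ (l, j) = 0" if "i < n" "l < n" "l < i \<or> j < l" for i j l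
    using that ut Suc B C by (auto simp: upper_triangular_def)
  have "(B ^\<^sub>m k * B) $$ (i, j) = 0" if "j < i" "i < n" for i j
  proof -
    have "\<forall>l\<in>{..<n}. (B ^\<^sub>m k) $$ (i, l) * B $$ (l, j) = 0"
    proof
      fix l assume "l \<in> {..<n}"
      moreover have "l < i \<or> j < l" using that by linarith
      ultimately show "(B ^\<^sub>m k) $$ (i, l) * B $$ (l, j) = 0" using that by (intro z) auto
    qed
    then show ?thesis using that by (subst entry) (auto intro!: sum.neutral)
  qed
  moreover have "(B ^\<^sub>m k * B) $$ (i, i) = B $$ (i, i) ^ Suc k" if "i < n" for i
  proof -
    have "(B ^\<^sub>m k * B) $$ (i, i) = (\<Sum>l<n. if l = i then (B ^\<^sub>m k) $$ (i, i) * B $$ (i, i) else 0)"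
      unfolding entry[OF that that]
    proof (rule sum.cong[OF refl])
      fix l assume l: "l \<in> {..<n}"
      show "(B ^\<^sub>m k) $$ (i, l) * B $$ (l, i)
          = (if l = i then (B ^\<^sub>m k) $$ (i, i) * B $$ (i, i) else 0)"
      proof (cases "l = i")
        case False
        then have "l < i \<or> i < l" by linarith
        then show ?thesis using z[of i l i] l that False by simp
      qed simp
    qed
    then show ?thesis using that Suc by simp
  qed
  ultimately show ?case using B by (auto simp: upper_triangular_def)
qed

text \<open>The eigenvalues are the diagonal of a triangular matrix similar to \<open>A\<close>, and powers of triangular
  matrices have the powers of the diagonal on their diagonal.\<close>

lemma Tr_eq_trace_pow:
  assumes A: "A \<in> carrier_mat n n"
  shows "Tr k A = trace (A ^\<^sub>m k)"
proof -
  let ?A = "map_mat complex_of_real A"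
  have cA: "?A \<in> carrier_mat n n" using A by simp
  obtain es where es: "char_poly ?A = (\<Prod>a\<leftarrow>es. [:- a, 1:])"
    using char_poly_factorized[OF cA] by blast
  obtain B where B: "B \<in> carrier_mat n n" "upper_triangular B" "similar_mat ?A B"
    using schur_decomposition_exists[OF cA es] by blast
  then obtain P Q where wit: "similar_mat_wit ?A B P Q" by (auto simp: similar_mat_def)
  have roots: "proots (\<Prod>a\<leftarrow>as. [:- a, 1:]) = mset as" for as :: "complex list"
  proof -
    have "proots (\<Prod>a\<leftarrow>as. [:- a, 1:]) = (\<Sum>a\<leftarrow>as. {#a#})"
      using proots_prod_list[of "map (\<lambda>a. [:- a, 1:]) as"] by (simp add: o_def image_iff)
    also have "\<dots> = mset as" by (induction as) auto
    finally show ?thesis .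
  qed
  have ev: "eigenvalues A = mset (diag_mat B)"
    unfolding eigenvalues_def char_poly_similar[OF B(3)] char_poly_upper_triangular[OF B(1,2)]
    by (rule roots)
  have "complex_of_real (Tr k A) = (\<Sum>\<beta>\<in>#eigenvalues A. \<beta> ^ k)"
    by (rule complex_of_real_Tr[OF A])
  also have "\<dots> = (\<Sum>i<n. B $$ (i, i) ^ k)"
  proof -
    have "(\<Sum>\<beta>\<in>#mset (map f [0..<m]). \<beta> ^ k) = (\<Sum>i<m. f i ^ k)" for f :: "nat \<Rightarrow> complex" and m
      by (induction m) auto
    then show ?thesis using B(1) by (simp add: ev diag_mat_def)
  qed
  also have "\<dots> = trace (B ^\<^sub>m k)"
  proof -
    have "(B ^\<^sub>m k) $$ (i, i) = B $$ (i, i) ^ k" if "i < n" for i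
      using upper_triangular_pow[OF B(1,2), of k] that by blast
    then show ?thesis unfolding trace_def using B(1) by (intro sum.cong) auto
  qed
  also have "\<dots> = trace (?A ^\<^sub>m k)"
    by (rule trace_similar[OF similar_mat_wit_pow[OF wit], symmetric])
  also have "?A ^\<^sub>m k = map_mat complex_of_real (A ^\<^sub>m k)"
    by (rule of_real_hom.mat_hom_pow[OF A, symmetric])
  also have "trace \<dots> = complex_of_real (trace (A ^\<^sub>m k))"
    using A by (simp add: trace_def)
  finally show ?thesis by (rule of_real_eq_iff[THEN iffD1])
qed

lemma pow_mat_add:
  fixes A :: "'a :: semiring_1 mat"
  assumes A: "A \<in> carrier_mat n n"
  shows "A ^\<^sub>m (j + k) = A ^\<^sub>m j * A ^\<^sub>m k"
proof (induction k)
  case (Suc k)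
  have "A ^\<^sub>m j * A ^\<^sub>m k * A = A ^\<^sub>m j * (A ^\<^sub>m k * A)"
    using A by (intro assoc_mult_mat) auto
  then show ?case using Suc by simp
qed (use A in simp)

lemma symmetric_square_diag:
  fixes M :: "real mat"
  assumes M: "M \<in> carrier_mat n n" "transpose_mat M = M" and i: "i < n"
  shows "(M * M) $$ (i, i) = (\<Sum>j<n. (M $$ (i, j))\<^sup>2)"
proof -
  have "M $$ (j, i) = M $$ (i, j)" if "j < n" for j
    using M i that index_transpose_mat(1)[of i M j] by simp
  then show ?thesis
    using M i by (simp add: scalar_prod_def lessThan_atLeast0 power2_eq_square)
qed

lemma symmetric_pow:
  fixes A :: "real mat"
  assumes A: "A \<in> carrier_mat n n" "transpose_mat A = A"
  shows "transpose_mat (A ^\<^sub>m k) = A ^\<^sub>m k"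
proof (induction k)
  case (Suc k)
  have "transpose_mat (A ^\<^sub>m k * A) = A * A ^\<^sub>m k"
    using A Suc transpose_mult[of "A ^\<^sub>m k" n n A n] by simp
  also have "\<dots> = A ^\<^sub>m (1 + k)" using A by (subst pow_mat_add[OF A(1)]) simp
  finally show ?case by simp
qed (use A in \<open>simp add: transpose_one\<close>)

text \<open>Each squaring step keeps only the diagonal term of \<open>(M\<^sup>2)\<^sub>i\<^sub>i = \<Sum>\<^sub>j M\<^sub>i\<^sub>j\<^sup>2\<close>, except the first one,
  where the whole row is kept.\<close>

lemma diag_pow_ge:
  fixes A :: "real mat"
  assumes A: "A \<in> carrier_mat n n" "transpose_mat A = A" and i: "i < n"
  shows "(\<Sum>j<n. (A $$ (i, j))\<^sup>2) ^ 2 ^ k \<le> (A ^\<^sub>m (2 ^ Suc k)) $$ (i, i)"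
proof (induction k)
  case 0
  have "A ^\<^sub>m (1 + 1) = A * A" using A by (subst pow_mat_add[OF A(1)]) simp
  then have "A ^\<^sub>m 2 = A * A" by (simp add: numeral_2_eq_2)
  then show ?case using symmetric_square_diag[OF A i] by simp
next
  case (Suc k)
  let ?M = "A ^\<^sub>m (2 ^ Suc k)"
  have M: "?M \<in> carrier_mat n n" "transpose_mat ?M = ?M" using A symmetric_pow[OF A] by auto
  have "(\<Sum>j<n. (A $$ (i, j))\<^sup>2) ^ 2 ^ Suc k = ((\<Sum>j<n. (A $$ (i, j))\<^sup>2) ^ 2 ^ k)\<^sup>2"
    by (simp add: mult.commute flip: power_mult)
  also have "\<dots> \<le> (?M $$ (i, i))\<^sup>2"
    by (intro power_mono[OF Suc] zero_le_power sum_nonneg zero_le_power2)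
  also have "\<dots> \<le> (\<Sum>j<n. (?M $$ (i, j))\<^sup>2)"
    using i by (intro member_le_sum) auto
  also have "\<dots> = (?M * ?M) $$ (i, i)" by (rule symmetric_square_diag[OF M i, symmetric])
  also have "?M * ?M = A ^\<^sub>m (2 ^ Suc k + 2 ^ Suc k)" by (rule pow_mat_add[OF A(1), symmetric])
  also have "2 ^ Suc k + 2 ^ Suc k = (2 ^ Suc (Suc k) :: nat)" by simp
  finally show ?case .
qed

section \<open>Powers of natural numbers lie above integer secants\<close>

lemma power_increment_mono:
  fixes d e :: nat
  assumes "d \<le> e"
  shows "real (d + 1) ^ m - real d ^ m \<le> real (e + 1) ^ m - real e ^ m"
proof (induction m)
  case (Suc m)
  have *: "real (k + 1) ^ Suc m - real k ^ Suc m
      = real k * (real (k + 1) ^ m - real k ^ m) + real (k + 1) ^ m" for k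
    by (simp add: algebra_simps)
  have "real d * (real (d + 1) ^ m - real d ^ m) \<le> real e * (real (e + 1) ^ m - real e ^ m)"
    using assms Suc by (intro mult_mono) (auto intro!: power_mono)
  moreover have "real (d + 1) ^ m \<le> real (e + 1) ^ m" using assms by (intro power_mono) auto
  ultimately show ?case unfolding * by linarith
qed simp

text \<open>The secant through the consecutive integers \<open>c\<close> and \<open>c + 1\<close> lies above the graph only strictly between
  them, where there is no natural number.\<close>

lemma power_secant_bound:
  "real c ^ m + (real (c + 1) ^ m - real c ^ m) * (real d - real c) \<le> real d ^ m"
proof (cases "c \<le> d")
  case True
  then show ?thesis
  proof (induction d rule: dec_induct)
    case (step e)
    have "real (c + 1) ^ m - real c ^ m \<le> real (e + 1) ^ m - real e ^ m"
      using step by (intro power_increment_mono) auto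
    then show ?case using step.IH by (simp add: algebra_simps)
  qed simp
next
  case False
  then have "d \<le> c" by simp
  then show ?thesis
  proof (induction rule: inc_induct)
    case (step e)
    have "real (e + 1) ^ m - real e ^ m \<le> real (c + 1) ^ m - real c ^ m"
      using step by (intro power_increment_mono) auto
    then show ?case using step.IH by (simp add: algebra_simps)
  qed simp
qed

section \<open>Conjugates of the eigenvalues of two by two matrices\<close>

lemma poly_of_rat_mult:
  fixes x :: "'a :: field_char_0"
  shows "poly (map_poly of_rat (p * q)) x = poly (map_poly of_rat p) x * poly (map_poly of_rat q) x"
proof -
  interpret h: map_poly_comm_ring_hom "of_rat :: rat \<Rightarrow> 'a" ..
  show ?thesis by (simp add: h.hom_mult)
qed

lemma ex_min_poly:
  fixes x :: complex
  assumes "algebraic x"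
  shows "\<exists>p. is_min_poly x p"
proof -
  let ?P = "\<lambda>q :: rat poly. q \<noteq> 0 \<and> poly (map_poly of_rat q) x = 0"
  have "\<exists>q. ?P q"
  proof -
    obtain p where p: "\<forall>i. coeff p i \<in> \<rat>" "p \<noteq> 0" "poly p x = 0"
      using assms algebraic_altdef by metis
    obtain q where "p = map_poly of_rat q" by (rule ratpolyE[of p]) (use p(1) in auto)
    then show ?thesis using p by auto
  qed
  then obtain q where q: "?P q" and least: "\<And>r. ?P r \<Longrightarrow> degree q \<le> degree r"
    using ex_has_least_nat[of ?P _ degree] by blast
  have irr: "irreducible q"
  proof (rule irreducibleI)
    show "\<not> q dvd 1"
    proof
      assume "q dvd 1"
      then have "degree q = 0" using q by (simp add: is_unit_iff_degree)
      then obtain c where "q = [:c:]" by (rule degree_eq_zeroE)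
      then show False using q by (simp add: of_rat_hom.map_poly_pCons_hom)
    qed
    fix a b assume ab: "q = a * b"
    then have nz: "a \<noteq> 0" "b \<noteq> 0" using q by auto
    then have deg: "degree q = degree a + degree b" using ab by (simp add: degree_mult_eq)
    have "poly (map_poly of_rat a) x * poly (map_poly of_rat b) x = 0"
      using q ab by (simp add: poly_of_rat_mult)
    then have "?P a \<or> ?P b" using nz by simp
    then have "degree b = 0 \<or> degree a = 0" using least[of a] least[of b] deg by linarith
    then show "a dvd 1 \<or> b dvd 1" using nz by (auto simp: is_unit_iff_degree)
  qed (use q in simp)
  define c where "c = inverse (lead_coeff q)"
  have c: "c \<noteq> 0" "c * lead_coeff q = 1" using q by (simp_all add: c_def)
  have "is_min_poly x (Polynomial.smult c q)"
    unfolding is_min_poly_def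
  proof (intro conjI)
    show "lead_coeff (Polynomial.smult c q) = 1" using c by simp
    show "irreducible (Polynomial.smult c q)"
    proof -
      have "[:c:] dvd 1" using c by (simp add: is_unit_iff_degree)
      then have "irreducible ([:c:] * q)" using irr by (simp only: irreducible_mult_unit_left)
      then show ?thesis by simp
    qed
    show "poly (map_poly of_rat (Polynomial.smult c q)) x = 0"
      using q poly_of_rat_mult[of "[:c:]" q x] by simp
  qed
  then show ?thesis ..
qed

lemma totally_positive_imp_pos:
  assumes "totally_positive x"
  shows "0 < Re x"
proof -
  obtain p where "is_min_poly x p" using ex_min_poly assms by (auto simp: totally_positive_def)
  then have "conjugate_over_Q x x" by (auto simp: conjugate_over_Q_def is_min_poly_def)
  then show ?thesis using assms by (auto simp: totally_positive_def)
qed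

text \<open>The graph of a homomorphism defined on a subring of the reals: the clause about \<open>(0, z)\<close> says that
  the relation is single valued. In the applications the subring is a quadratic or biquadratic number field
  and the homomorphism a Galois automorphism of it.\<close>

definition conj_relation :: "(real \<times> real) set \<Rightarrow> bool" where
  "conj_relation G \<longleftrightarrow>
     (\<forall>a a' b b'. (a, a') \<in> G \<longrightarrow> (b, b') \<in> G \<longrightarrow> (a + b, a' + b') \<in> G \<and> (a * b, a' * b') \<in> G) \<and>
     (\<forall>q. (of_rat q, of_rat q) \<in> G) \<and> (\<forall>z. (0, z) \<in> G \<longrightarrow> z = 0)"

text \<open>Modulo \<open>u\<^sup>2 = T u - D\<close> the polynomial \<open>h\<close> reduces to some \<open>a + b u\<close> with \<open>a\<close> and \<open>b\<close> in the subring, and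
  the reduction commutes with the homomorphism. Two distinct roots force \<open>a = b = 0\<close>, hence also
  the images \<open>a' = b' = 0\<close>.\<close>

lemma conj_root:
  fixes h :: "rat poly"
  assumes G: "conj_relation G" and T: "(T, T') \<in> G" and D: "(D, D') \<in> G"
    and x: "x\<^sup>2 = T * x - D" "poly (map_poly of_rat h) x = 0"
    and y: "y\<^sup>2 = T * y - D" "poly (map_poly of_rat h) y = 0" and "x \<noteq> y"
    and z: "z\<^sup>2 = T' * z - D'"
  shows "poly (map_poly of_rat h) z = 0"
proof -
  have add: "(a + b, a' + b') \<in> G" and mult: "(a * b, a' * b') \<in> G"
    if "(a, a') \<in> G" "(b, b') \<in> G" for a a' b b'
    using G that by (auto simp: conj_relation_def)
  have rat: "(of_rat q, of_rat q) \<in> G" for q using G by (simp add: conj_relation_def)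
  have zero: "w = 0" if "(0, w) \<in> G" for w using G that by (simp add: conj_relation_def)
  have "\<exists>a a' b b'. (a, a') \<in> G \<and> (b, b') \<in> G \<and>
      (\<forall>u. u\<^sup>2 = T * u - D \<longrightarrow> poly (map_poly of_rat h) u = a + b * u) \<and>
      (\<forall>u. u\<^sup>2 = T' * u - D' \<longrightarrow> poly (map_poly of_rat h) u = a' + b' * u)"
  proof (induction h)
    case 0
    show ?case using rat[of 0] by (intro exI[of _ 0]) simp
  next
    case (pCons c h)
    then obtain a a' b b' where ab: "(a, a') \<in> G" "(b, b') \<in> G"
      "\<And>u. u\<^sup>2 = T * u - D \<Longrightarrow> poly (map_poly of_rat h) u = a + b * u"
      "\<And>u. u\<^sup>2 = T' * u - D' \<Longrightarrow> poly (map_poly of_rat h) u = a' + b' * u" by blast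
    have step: "of_rat c + u * (p + q * u) = (of_rat c + of_rat (-1) * (q * E)) + (p + q * S) * u"
      if "u\<^sup>2 = S * u - E" for u p q S E :: real
    proof -
      have "u * (q * u) = q * (S * u - E)" unfolding that[symmetric] by (simp add: power2_eq_square)
      then show ?thesis by (simp add: algebra_simps)
    qed
    have 1: "poly (map_poly of_rat (pCons c h)) u
        = (of_rat c + of_rat (-1) * (b * D)) + (a + b * T) * u" if "u\<^sup>2 = T * u - D" for u
      using step[OF that, of a b] ab(3)[OF that] by (simp add: of_rat_hom.map_poly_pCons_hom)
    have 2: "poly (map_poly of_rat (pCons c h)) u
        = (of_rat c + of_rat (-1) * (b' * D')) + (a' + b' * T') * u" if "u\<^sup>2 = T' * u - D'" for u
      using step[OF that, of a' b'] ab(4)[OF that] by (simp add: of_rat_hom.map_poly_pCons_hom)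
    have 3: "(of_rat c + of_rat (-1) * (b * D), of_rat c + of_rat (-1) * (b' * D')) \<in> G"
      "(a + b * T, a' + b' * T') \<in> G"
      by (intro add mult rat ab T D)+
    show ?case using 1 2 3 by blast
  qed
  then obtain a a' b b' where ab: "(a, a') \<in> G" "(b, b') \<in> G"
    "\<And>u. u\<^sup>2 = T * u - D \<Longrightarrow> poly (map_poly of_rat h) u = a + b * u"
    "\<And>u. u\<^sup>2 = T' * u - D' \<Longrightarrow> poly (map_poly of_rat h) u = a' + b' * u" by blast
  have eqs: "a + b * x = 0" "a + b * y = 0" using ab(3)[OF x(1)] ab(3)[OF y(1)] x(2) y(2) by simp_all
  have "b * (x - y) = (a + b * x) - (a + b * y)" by (simp add: algebra_simps)
  then have "b * (x - y) = 0" unfolding eqs by simp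
  then have "b = 0" using \<open>x \<noteq> y\<close> by simp
  moreover from this have "a = 0" using eqs by simp
  ultimately have "a' = 0" "b' = 0" using ab(1,2) zero by auto
  then show ?thesis using ab(4)[OF z] by simp
qed

lemma root_in_eigenvalues_2:
  assumes A: "A \<in> carrier_mat 2 2" "A $$ (1, 0) = A $$ (0, 1)" "A $$ (0, 1) \<noteq> 0"
    and x: "x\<^sup>2 = (A $$ (0, 0) + A $$ (1, 1)) * x - (A $$ (0, 0) * A $$ (1, 1) - (A $$ (0, 1))\<^sup>2)"
  shows "complex_of_real x \<in># eigenvalues A"
proof -
  \<comment> \<open>the vector that the first row of \<open>A - x\<close> annihilates\<close>
  define v where "v = (\<lambda>i :: nat. if i = 0 then A $$ (0, 1) else x - A $$ (0, 0))"
  have "(\<Sum>j<2. A $$ (i, j) * v j) = x * v i" if "i < 2" for i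
  proof -
    have "i = 0 \<or> i = 1" using that by linarith
    then show ?thesis
      using x A(2) by (auto simp: v_def numeral_2_eq_2 power2_eq_square algebra_simps)
  qed
  then show ?thesis
    using A by (intro real_eigenpair_in_eigenvalues[OF A(1), of 0 v x]) (auto simp: v_def)
qed

text \<open>The product of the minimal polynomials of the two eigenvalues has only positive roots, and by
  \<open>conj_root\<close> the real roots of the conjugate of the characteristic polynomial are among them.\<close>

lemma conj_root_pos_2:
  assumes A: "A \<in> carrier_mat 2 2" "A $$ (1, 0) = A $$ (0, 1)" "A $$ (0, 1) \<noteq> 0"
    and pd: "positive_definite A"
    and G: "conj_relation G" and T: "(A $$ (0, 0) + A $$ (1, 1), T') \<in> G"
    and D: "(A $$ (0, 0) * A $$ (1, 1) - (A $$ (0, 1))\<^sup>2, D') \<in> G"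
    and z: "z\<^sup>2 = T' * z - D'"
  shows "0 < z"
proof -
  define T where "T = A $$ (0, 0) + A $$ (1, 1)"
  define D where "D = A $$ (0, 0) * A $$ (1, 1) - (A $$ (0, 1))\<^sup>2"
  define r where "r = sqrt ((A $$ (0, 0) - A $$ (1, 1))\<^sup>2 + 4 * (A $$ (0, 1))\<^sup>2)"
  define x where "x = (T + r) / 2"
  define y where "y = (T - r) / 2"
  have disc: "0 < (A $$ (0, 0) - A $$ (1, 1))\<^sup>2 + 4 * (A $$ (0, 1))\<^sup>2"
    using A(3) by (intro add_nonneg_pos) auto
  then have r: "r > 0" by (simp add: r_def)
  have r2: "r\<^sup>2 = T\<^sup>2 - 4 * D"
    using disc by (simp add: r_def T_def D_def power2_eq_square algebra_simps)
  have x: "x\<^sup>2 = T * x - D" and y: "y\<^sup>2 = T * y - D"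
    using r2 by (simp_all add: x_def y_def power2_eq_square field_simps)
  have "totally_positive x" "totally_positive y"
    using pd root_in_eigenvalues_2[OF A] x y by (auto simp: positive_definite_def T_def D_def)
  then obtain p q where p: "is_min_poly x p" and q: "is_min_poly y q"
    and tp: "totally_positive x" "totally_positive y"
    using ex_min_poly by (meson totally_positive_def)
  have "complex_of_real (of_rat c) = of_rat c" for c
    by (cases c) (simp add: of_rat_rat)
  then have ev: "poly (map_poly of_rat u) (complex_of_real w) = complex_of_real (poly (map_poly of_rat u) w)"
    for u :: "rat poly" and w :: real
    by (induction u) (simp_all add: of_rat_hom.map_poly_pCons_hom)
  have px: "poly (map_poly of_rat p) x = 0" and qy: "poly (map_poly of_rat q) y = 0"
    using p q by (simp_all add: is_min_poly_def ev)
  have "poly (map_poly of_rat (p * q)) z = 0"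
    by (rule conj_root[OF G T[folded T_def] D[folded D_def] x _ y _ _ z])
      (use px qy r in \<open>simp_all add: poly_of_rat_mult x_def y_def\<close>)
  then have "poly (map_poly of_rat p) z = 0 \<or> poly (map_poly of_rat q) z = 0"
    by (simp add: poly_of_rat_mult)
  then have "conjugate_over_Q x z \<or> conjugate_over_Q y z"
    using p q unfolding conjugate_over_Q_def by (metis ev of_real_0)
  then show ?thesis using tp by (auto simp: totally_positive_def)
qed

lemma sqrt_irrational:
  assumes "k\<^sup>2 < c" "c < (k + 1)\<^sup>2"
  shows "sqrt (real c) \<notin> \<rat>"
proof
  assume "sqrt (real c) \<in> \<rat>"
  then have "sqrt (real c) \<in> \<int>" by (rule Ints_if_Rats_square_Ints) auto
  then obtain m where m: "sqrt (real c) = of_int m" by (auto elim: Ints_cases)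
  have "real k < sqrt (real c)" using assms(1) by (intro real_less_rsqrt) (simp flip: of_nat_power)
  moreover have "sqrt (real c) < real (k + 1)"
    using assms(2) by (intro real_less_lsqrt) (simp_all flip: of_nat_power of_nat_Suc)
  ultimately have "real_of_int (int k) < of_int m" "real_of_int m < of_int (int k + 1)"
    unfolding m by simp_all
  then show False unfolding of_int_less_iff by linarith
qed

definition sqrt_conj :: "nat \<Rightarrow> (real \<times> real) set" where
  "sqrt_conj c = {(x + y * sqrt c, x - y * sqrt c) |x y. x \<in> \<rat> \<and> y \<in> \<rat>}"

lemma sqrt_conjI:
  assumes "x \<in> \<rat>" "y \<in> \<rat>" "a = x + y * sqrt (real c)" "a' = x - y * sqrt (real c)"
  shows "(a, a') \<in> sqrt_conj c"
  using assms unfolding sqrt_conj_def by blast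

lemma sqrt_conjE:
  assumes "(a, a') \<in> sqrt_conj c"
  obtains x y where "x \<in> \<rat>" "y \<in> \<rat>" "a = x + y * sqrt (real c)" "a' = x - y * sqrt (real c)"
  using assms unfolding sqrt_conj_def by blast

lemma conj_relation_sqrt:
  assumes c: "sqrt (real c) \<notin> \<rat>"
  shows "conj_relation (sqrt_conj c)" (is "conj_relation ?G")
proof -
  have expand: "(x + y * t) * (u + v * t) = (x * u + y * v * (t * t)) + (x * v + y * u) * t"
    for x y u v t :: real by (simp add: algebra_simps)
  have add: "(a + b, a' + b') \<in> ?G \<and> (a * b, a' * b') \<in> ?G"
    if ab: "(a, a') \<in> ?G" "(b, b') \<in> ?G" for a a' b b'
  proof -
    obtain x y where 1: "x \<in> \<rat>" "y \<in> \<rat>" "a = x + y * sqrt c" "a' = x - y * sqrt c" by (rule sqrt_conjE[OF ab(1)])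
    obtain u v where 2: "u \<in> \<rat>" "v \<in> \<rat>" "b = u + v * sqrt c" "b' = u - v * sqrt c"
      by (rule sqrt_conjE[OF ab(2)])
    have s: "sqrt c * sqrt c = real c" by simp
    have "a + b = (x + u) + (y + v) * sqrt c" "a' + b' = (x + u) - (y + v) * sqrt c"
      using 1 2 by (simp_all add: algebra_simps)
    moreover have "x + u \<in> \<rat>" "y + v \<in> \<rat>" using 1 2 by auto
    ultimately have A: "(a + b, a' + b') \<in> ?G" by (intro sqrt_conjI)
    have "a * b = (x * u + y * v * (sqrt c * sqrt c)) + (x * v + y * u) * sqrt c"
      "a' * b' = (x * u + y * v * (sqrt c * sqrt c)) - (x * v + y * u) * sqrt c"
      unfolding 1 2 using expand[of x y "sqrt c" u v] expand[of x y "- sqrt c" u v] by simp_all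
    moreover have "x * u + y * v * (sqrt c * sqrt c) \<in> \<rat>" "x * v + y * u \<in> \<rat>"
      unfolding s using 1 2 by (auto intro!: Rats_add Rats_mult)
    ultimately have "(a * b, a' * b') \<in> ?G" by (intro sqrt_conjI)
    then show ?thesis using A by blast
  qed
  have rat: "(of_rat q, of_rat q) \<in> ?G" for q by (rule sqrt_conjI[of "of_rat q" 0]) simp_all
  have zero: "z = 0" if mem: "(0, z) \<in> ?G" for z
  proof -
    obtain x y where 1: "x \<in> \<rat>" "y \<in> \<rat>" "0 = x + y * sqrt c" "z = x - y * sqrt c"
      by (rule sqrt_conjE[OF mem])
    have "y = 0"
    proof (rule ccontr)
      assume "y \<noteq> 0"
      then have "sqrt c = - x / y" using 1(3) by (simp add: field_simps)
      also have "\<dots> \<in> \<rat>" using 1 by (intro Rats_divide) auto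
      finally show False using c by simp
    qed
    then show ?thesis using 1 by simp
  qed
  show ?thesis unfolding conj_relation_def using add rat zero by blast
qed

lemma rational_square_ratio_imp_0:
  assumes "sqrt (real c) \<notin> \<rat>" "x \<in> \<rat>" "y \<in> \<rat>" "x\<^sup>2 = real c * y\<^sup>2"
  shows "y = 0"
proof (rule ccontr)
  assume y: "y \<noteq> 0"
  have "sqrt (x\<^sup>2) = sqrt (real c * y\<^sup>2)" using assms(4) by simp
  then have "\<bar>x\<bar> = sqrt (real c) * \<bar>y\<bar>" by (simp add: real_sqrt_mult)
  then have "sqrt (real c) = \<bar>x\<bar> / \<bar>y\<bar>" using y by simp
  also have "\<dots> \<in> \<rat>" using assms by (intro Rats_divide) auto
  finally show False using assms(1) by simp
qed

text \<open>The automorphism of \<open>\<rat>(\<surd>2, \<surd>3)\<close> that changes the sign of both square roots.\<close>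

definition sqrt2_sqrt3_conj :: "(real \<times> real) set" where
  "sqrt2_sqrt3_conj =
     {(x + y * sqrt 2 + z * sqrt 3 + w * sqrt 6, x - y * sqrt 2 - z * sqrt 3 + w * sqrt 6)
     |x y z w. x \<in> \<rat> \<and> y \<in> \<rat> \<and> z \<in> \<rat> \<and> w \<in> \<rat>}"

lemma sqrt2_sqrt3_conjI:
  assumes "x \<in> \<rat>" "y \<in> \<rat>" "z \<in> \<rat>" "w \<in> \<rat>"
    "a = x + y * sqrt 2 + z * sqrt 3 + w * sqrt 6" "a' = x - y * sqrt 2 - z * sqrt 3 + w * sqrt 6"
  shows "(a, a') \<in> sqrt2_sqrt3_conj"
  using assms unfolding sqrt2_sqrt3_conj_def by blast

lemma sqrt2_sqrt3_conjE:
  assumes "(a, a') \<in> sqrt2_sqrt3_conj"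
  obtains x y z w where "x \<in> \<rat>" "y \<in> \<rat>" "z \<in> \<rat>" "w \<in> \<rat>"
    "a = x + y * sqrt 2 + z * sqrt 3 + w * sqrt 6" "a' = x - y * sqrt 2 - z * sqrt 3 + w * sqrt 6"
  using assms unfolding sqrt2_sqrt3_conj_def by blast

lemma conj_relation_sqrt2_sqrt3: "conj_relation sqrt2_sqrt3_conj" (is "conj_relation ?G")
proof -
  have s: "sqrt 2 * sqrt 2 = 2" "sqrt 3 * sqrt 3 = (3 :: real)" and s6: "sqrt 6 = sqrt 2 * sqrt (3 :: real)"
    by (simp_all flip: real_sqrt_mult)
  have expand: "(x1 + y1 * p + z1 * q + w1 * (p * q)) * (x2 + y2 * p + z2 * q + w2 * (p * q))
      = (x1 * x2 + (p * p) * (y1 * y2) + (q * q) * (z1 * z2) + (p * p) * (q * q) * (w1 * w2))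
        + (x1 * y2 + y1 * x2 + (q * q) * (z1 * w2) + (q * q) * (w1 * z2)) * p
        + (x1 * z2 + z1 * x2 + (p * p) * (y1 * w2) + (p * p) * (w1 * y2)) * q
        + (x1 * w2 + w1 * x2 + y1 * z2 + z1 * y2) * (p * q)"
    for x1 y1 z1 w1 x2 y2 z2 w2 p q :: real by (simp add: algebra_simps)
  have irr: "sqrt (real 2) \<notin> \<rat>" "sqrt (real 3) \<notin> \<rat>" "sqrt (real 6) \<notin> \<rat>"
    using sqrt_irrational[of 1 2] sqrt_irrational[of 1 3] sqrt_irrational[of 2 6]
    by (simp_all add: power2_eq_square)
  have add: "(a + b, a' + b') \<in> ?G \<and> (a * b, a' * b') \<in> ?G"
    if ab: "(a, a') \<in> ?G" "(b, b') \<in> ?G" for a a' b b'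
  proof -
    obtain x1 y1 z1 w1 where 1: "x1 \<in> \<rat>" "y1 \<in> \<rat>" "z1 \<in> \<rat>" "w1 \<in> \<rat>"
      "a = x1 + y1 * sqrt 2 + z1 * sqrt 3 + w1 * sqrt 6"
      "a' = x1 - y1 * sqrt 2 - z1 * sqrt 3 + w1 * sqrt 6" by (rule sqrt2_sqrt3_conjE[OF ab(1)])
    obtain x2 y2 z2 w2 where 2: "x2 \<in> \<rat>" "y2 \<in> \<rat>" "z2 \<in> \<rat>" "w2 \<in> \<rat>"
      "b = x2 + y2 * sqrt 2 + z2 * sqrt 3 + w2 * sqrt 6"
      "b' = x2 - y2 * sqrt 2 - z2 * sqrt 3 + w2 * sqrt 6" by (rule sqrt2_sqrt3_conjE[OF ab(2)])
    have "a + b = (x1 + x2) + (y1 + y2) * sqrt 2 + (z1 + z2) * sqrt 3 + (w1 + w2) * sqrt 6"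
      "a' + b' = (x1 + x2) - (y1 + y2) * sqrt 2 - (z1 + z2) * sqrt 3 + (w1 + w2) * sqrt 6"
      using 1 2 by (simp_all add: algebra_simps)
    moreover have "x1 + x2 \<in> \<rat>" "y1 + y2 \<in> \<rat>" "z1 + z2 \<in> \<rat>" "w1 + w2 \<in> \<rat>" using 1 2 by auto
    ultimately have A: "(a + b, a' + b') \<in> ?G" by (intro sqrt2_sqrt3_conjI)
    define X where "X = x1 * x2 + 2 * (y1 * y2) + 3 * (z1 * z2) + 6 * (w1 * w2)"
    define Y where "Y = x1 * y2 + y1 * x2 + 3 * (z1 * w2) + 3 * (w1 * z2)"
    define Z where "Z = x1 * z2 + z1 * x2 + 2 * (y1 * w2) + 2 * (w1 * y2)"
    define W where "W = x1 * w2 + w1 * x2 + y1 * z2 + z1 * y2"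
    have "a * b = X + Y * sqrt 2 + Z * sqrt 3 + W * sqrt 6"
      "a' * b' = X - Y * sqrt 2 - Z * sqrt 3 + W * sqrt 6"
      unfolding 1 2 s6 X_def Y_def Z_def W_def
      using expand[of x1 y1 "sqrt 2" z1 "sqrt 3" w1 x2 y2 z2 w2]
        expand[of x1 y1 "- sqrt 2" z1 "- sqrt 3" w1 x2 y2 z2 w2]
      unfolding s minus_mult_minus by argo+
    moreover have "X \<in> \<rat>" "Y \<in> \<rat>" "Z \<in> \<rat>" "W \<in> \<rat>"
      unfolding X_def Y_def Z_def W_def using 1 2 by (auto intro!: Rats_add Rats_mult)
    ultimately have "(a * b, a' * b') \<in> ?G" by (intro sqrt2_sqrt3_conjI)
    then show ?thesis using A by blast
  qed
  have rat: "(of_rat q, of_rat q) \<in> ?G" for q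
    by (rule sqrt2_sqrt3_conjI[of "of_rat q" 0 0 0]) simp_all
  have zero: "u = 0" if mem: "(0, u) \<in> ?G" for u
  proof -
    obtain x y z w where 1: "x \<in> \<rat>" "y \<in> \<rat>" "z \<in> \<rat>" "w \<in> \<rat>"
      "0 = x + y * sqrt 2 + z * sqrt 3 + w * sqrt 6" "u = x - y * sqrt 2 - z * sqrt 3 + w * sqrt 6"
      by (rule sqrt2_sqrt3_conjE[OF mem])
    \<comment> \<open>squaring moves the relation into \<open>\<rat>(\<surd>6)\<close>, where coefficients can be compared\<close>
    have "x + w * sqrt 6 = - (y * sqrt 2 + z * sqrt 3)" using 1(5) by linarith
    then have "(x + w * sqrt 6)\<^sup>2 = (y * sqrt 2 + z * sqrt 3)\<^sup>2" by (simp only: power2_minus)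
    moreover have "(x + w * sqrt 6)\<^sup>2 = x\<^sup>2 + 6 * w\<^sup>2 + 2 * x * w * sqrt 6"
      by (simp add: power2_sum power_mult_distrib)
    moreover have "(y * sqrt 2 + z * sqrt 3)\<^sup>2 = 2 * y\<^sup>2 + 3 * z\<^sup>2 + 2 * y * z * sqrt 6"
      by (simp add: power2_sum power_mult_distrib s6)
    ultimately have eq: "2 * (x * w - y * z) * sqrt 6 = 2 * y\<^sup>2 + 3 * z\<^sup>2 - x\<^sup>2 - 6 * w\<^sup>2"
      by (simp add: algebra_simps)
    have xw: "x * w = y * z"
    proof (rule ccontr)
      assume "x * w \<noteq> y * z"
      then have "sqrt (real 6) = (2 * y\<^sup>2 + 3 * z\<^sup>2 - x\<^sup>2 - 6 * w\<^sup>2) / (2 * (x * w - y * z))"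
        using eq by (simp add: field_simps)
      also have "\<dots> \<in> \<rat>" using 1(1-4) by (intro Rats_divide Rats_diff Rats_add Rats_mult) auto
      finally show False using irr by simp
    qed
    then have eq2: "2 * y\<^sup>2 + 3 * z\<^sup>2 = x\<^sup>2 + 6 * w\<^sup>2" using eq by simp
    have w0: "w = 0"
    proof (rule ccontr)
      assume w: "w \<noteq> 0"
      have "(y\<^sup>2 - 3 * w\<^sup>2) * (z\<^sup>2 - 2 * w\<^sup>2) = (y * z)\<^sup>2 - w\<^sup>2 * (2 * y\<^sup>2 + 3 * z\<^sup>2) + 6 * (w\<^sup>2 * w\<^sup>2)"
        by (simp add: power2_eq_square algebra_simps)
      also have "\<dots> = 0" unfolding eq2 xw[symmetric] by (simp add: power2_eq_square algebra_simps)
      finally have "(y\<^sup>2 - 3 * w\<^sup>2) * (z\<^sup>2 - 2 * w\<^sup>2) = 0" .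
      then have "y\<^sup>2 = real 3 * w\<^sup>2 \<or> z\<^sup>2 = real 2 * w\<^sup>2" by auto
      then show False using rational_square_ratio_imp_0[OF irr(2), of y w] rational_square_ratio_imp_0[OF irr(1), of z w] 1 w by auto
    qed
    then have "y * z = 0" using xw by simp
    then have "y = 0 \<and> z = 0 \<and> x = 0"
    proof (cases "y = 0")
      case True
      then have "x\<^sup>2 = real 3 * z\<^sup>2" using eq2 w0 by simp
      then show ?thesis using rational_square_ratio_imp_0[OF irr(2), of x z] 1 True by simp
    next
      case False
      then have "z = 0" using \<open>y * z = 0\<close> by simp
      then have "x\<^sup>2 = real 2 * y\<^sup>2" using eq2 w0 by simp
      then show ?thesis using rational_square_ratio_imp_0[OF irr(1), of x y] 1 False by simp
    qed
    then show ?thesis using 1 w0 by simp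
  qed
  show ?thesis unfolding conj_relation_def using add rat zero by blast
qed

lemma quadratic_nonpos_root:
  fixes T D :: real
  assumes "D < 0"
  shows "\<exists>z\<le>0. z\<^sup>2 = T * z - D"
proof (intro exI conjI)
  let ?r = "sqrt (T\<^sup>2 - 4 * D)"
  have "\<bar>T\<bar> \<le> ?r" using assms by (intro real_le_rsqrt) simp
  then have "T \<le> ?r" by (rule abs_le_D1)
  then show "(T - ?r) / 2 \<le> 0" by simp
  have "?r\<^sup>2 = T\<^sup>2 - 4 * D" using assms zero_le_power2[of T] by (intro real_sqrt_pow2) linarith
  then show "((T - ?r) / 2)\<^sup>2 = T * ((T - ?r) / 2) - D" by (simp add: power2_eq_square field_simps)
qed

text \<open>For the diagonal \<open>1, \<surd>m\<close> the conjugate of the determinant \<open>\<surd>m - 1\<close> is negative. For the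
  diagonals \<open>\<surd>m, \<surd>m\<close> and \<open>\<surd>2, \<surd>3\<close> there is an automorphism that fixes the determinant and changes the sign of the
  trace, so that the negatives of the eigenvalues are conjugate to eigenvalues.\<close>

lemma small_diagonal_not_positive_definite:
  assumes A: "A \<in> carrier_mat 2 2" "A $$ (1, 0) = A $$ (0, 1)" "(A $$ (0, 1))\<^sup>2 = 1"
    and diag: "A $$ (0, 0) = sqrt (real a)" "A $$ (1, 1) = sqrt (real c)"
    and small: "a \<in> {1, 2, 3}" "c \<in> {1, 2, 3}" "a * c \<noteq> 1"
  shows "\<not> positive_definite A"
proof
  assume pd: "positive_definite A"
  have A01: "A $$ (0, 1) \<noteq> 0" using A(3) by auto
  note pos = conj_root_pos_2[OF A(1,2) A01 pd]
  have irr: "sqrt (real 2) \<notin> \<rat>" "sqrt (real 3) \<notin> \<rat>"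
    using sqrt_irrational[of 1 2] sqrt_irrational[of 1 3]
    by (simp_all add: power2_eq_square)
  have one: False if "A $$ (0, 0) + A $$ (1, 1) = 1 + sqrt (real m)"
    "A $$ (0, 0) * A $$ (1, 1) = sqrt (real m)" "sqrt (real m) \<notin> \<rat>" for m
  proof -
    have "0 \<le> sqrt (real m)" by simp
    then have "- 1 - sqrt (real m) < 0" by linarith
    then obtain z where z: "z \<le> 0" "z\<^sup>2 = (1 - sqrt (real m)) * z - (- 1 - sqrt (real m))"
      using quadratic_nonpos_root by blast
    have "0 < z"
    proof (rule pos[OF conj_relation_sqrt[OF that(3)] _ _ z(2)])
      show "(A $$ (0, 0) + A $$ (1, 1), 1 - sqrt (real m)) \<in> sqrt_conj m"
        unfolding that(1) by (rule sqrt_conjI[of 1 1]) simp_all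
      show "(A $$ (0, 0) * A $$ (1, 1) - (A $$ (0, 1))\<^sup>2, - 1 - sqrt (real m)) \<in> sqrt_conj m"
        unfolding that(2) A(3) by (rule sqrt_conjI[of "-1" 1]) simp_all
    qed
    then show False using z(1) by simp
  qed
  have same: False if "A $$ (0, 0) = sqrt (real m)" "A $$ (1, 1) = sqrt (real m)"
    "sqrt (real m) \<notin> \<rat>" for m
  proof -
    have s: "sqrt (real m) * sqrt (real m) = real m" by simp
    define z where "z = - sqrt (real m) - 1"
    have z: "z\<^sup>2 = - 2 * sqrt (real m) * z - (real m - 1)"
      unfolding z_def by (simp add: power2_eq_square algebra_simps)
    have "0 < z"
    proof (rule pos[OF conj_relation_sqrt[OF that(3)] _ _ z])
      show "(A $$ (0, 0) + A $$ (1, 1), - 2 * sqrt (real m)) \<in> sqrt_conj m"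
        unfolding that by (rule sqrt_conjI[of 0 2]) simp_all
      show "(A $$ (0, 0) * A $$ (1, 1) - (A $$ (0, 1))\<^sup>2, real m - 1) \<in> sqrt_conj m"
        unfolding that A(3) s by (rule sqrt_conjI[of "real m - 1" 0]) simp_all
    qed
    then show False by (simp add: z_def) (smt (verit) real_sqrt_ge_0_iff of_nat_0_le_iff)
  qed
  have mixed: False if "A $$ (0, 0) + A $$ (1, 1) = sqrt 2 + sqrt 3"
    "A $$ (0, 0) * A $$ (1, 1) = sqrt 6"
  proof -
    define T where "T = sqrt 2 + sqrt (3 :: real)"
    define r where "r = sqrt (T\<^sup>2 - 4 * (sqrt 6 - 1))"
    define z where "z = - (T + r) / 2"
    have T2: "T\<^sup>2 = 5 + 2 * sqrt 6"
      by (simp add: T_def power2_sum flip: real_sqrt_mult)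
    have s6: "sqrt 6 < (3 :: real)" by (rule real_less_lsqrt) auto
    have nn: "0 \<le> T\<^sup>2 - 4 * (sqrt 6 - 1)" unfolding T2
    proof -
      have "0 \<le> 5 + 2 * s - 4 * (s - 1)" if "s < 3" for s :: real using that by simp
      then show "0 \<le> 5 + 2 * sqrt 6 - 4 * (sqrt 6 - (1 :: real))" using s6 by blast
    qed
    then have r: "0 \<le> r" "r\<^sup>2 = T\<^sup>2 - 4 * (sqrt 6 - 1)" by (auto simp: r_def)
    have z: "z\<^sup>2 = - T * z - (sqrt 6 - 1)"
      using r(2) by (simp add: z_def power2_eq_square field_simps)
    have "0 < z"
    proof (rule pos[OF conj_relation_sqrt2_sqrt3 _ _ z])
      show "(A $$ (0, 0) + A $$ (1, 1), - T) \<in> sqrt2_sqrt3_conj"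
        unfolding that T_def
        by (rule sqrt2_sqrt3_conjI[of 0 1 1 0]) simp_all
      show "(A $$ (0, 0) * A $$ (1, 1) - (A $$ (0, 1))\<^sup>2, sqrt 6 - 1) \<in> sqrt2_sqrt3_conj"
        unfolding that A(3) by (rule sqrt2_sqrt3_conjI[of "-1" 0 0 1]) simp_all
    qed
    moreover have "0 \<le> T" by (simp add: T_def)
    ultimately show False using r(1) by (simp add: z_def)
  qed
  have p6: "sqrt 2 * sqrt 3 = sqrt (6 :: real)" "sqrt 3 * sqrt 2 = sqrt (6 :: real)"
    by (simp_all flip: real_sqrt_mult)
  consider "a = 1" "c = 2" | "a = 1" "c = 3" | "a = 2" "c = 1" | "a = 3" "c = 1" | "a = 2" "c = 2"
    | "a = 3" "c = 3" | "a = 2" "c = 3" | "a = 3" "c = 2" using small by auto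
  then show False
  proof cases
    case 1 then show ?thesis using one[of 2] diag irr by simp
  next
    case 2 then show ?thesis using one[of 3] diag irr by simp
  next
    case 3 then show ?thesis using one[of 2] diag irr by simp
  next
    case 4 then show ?thesis using one[of 3] diag irr by simp
  next
    case 5 then show ?thesis using same[of 2] diag irr by simp
  next
    case 6 then show ?thesis using same[of 3] diag irr by simp
  next
    case 7 then show ?thesis using mixed diag p6 by simp
  next
    case 8 then show ?thesis using mixed diag p6 by (simp add: add.commute)
  qed
qed

section \<open>Reduction of both classes to rational forms\<close>

lemma symmetric_mat_index:
  assumes "symmetric_mat A" "A \<in> carrier_mat n n" "i < n" "j < n"
  shows "A $$ (i, j) = A $$ (j, i)"
proof -
  have "A $$ (i, j) = transpose_mat A $$ (i, j)" using assms(1) by (simp add: symmetric_mat_def)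
  also have "\<dots> = A $$ (j, i)" using assms(2-4) by simp
  finally show ?thesis .
qed

lemma covers_of_path:
  assumes sym: "\<And>i j. i < n \<Longrightarrow> j < n \<Longrightarrow> b i j = b j i"
    and up: "\<And>i. i + 1 < n \<Longrightarrow> b i (i + 1) \<noteq> 0" and i: "i < (n :: nat)"
  shows "covers {..<n} b {i}"
  unfolding covers_def
proof (intro conjI allI impI)
  fix R assume R: "closed_in {..<n} b R" "{i} \<subseteq> R"
  have edge: "k \<in> R" if "j \<in> R" "k < n" "b j k \<noteq> 0" for j k
    using R(1) that by (auto simp: closed_in_def)
  have "k < n \<longrightarrow> k \<in> R" if "i \<le> k" for k
    using that
  proof (induction rule: dec_induct)
    case (step m)
    then show ?case using up[of m] edge[of m "Suc m"] by auto
  qed (use R in simp)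
  moreover have "k \<in> R" if "k \<le> i" for k
    using that
  proof (induction rule: inc_induct)
    case (step m)
    then have "b (Suc m) m \<noteq> 0" using up[of m] sym[of m "Suc m"] i by simp
    then show ?case using step i edge[of "Suc m" m] by auto
  qed (use R in simp)
  ultimately have "{..<n} \<subseteq> R" by (meson lessThan_iff nat_le_linear subsetI)
  then show "R = {..<n}" using R(1) by (auto simp: closed_in_def)
qed (use i in simp)

lemma diagonal_mult_left:
  fixes D M :: "'a :: semiring_1 mat"
  assumes "D \<in> carrier_mat n n" "diagonal_mat D" "M \<in> carrier_mat n n" "i < n" "j < n"
  shows "(D * M) $$ (i, j) = D $$ (i, i) * M $$ (i, j)"
proof -
  have "(D * M) $$ (i, j) = (\<Sum>k<n. D $$ (i, k) * M $$ (k, j))"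
    using assms by (simp add: scalar_prod_def lessThan_atLeast0)
  also have "\<dots> = (\<Sum>k<n. if k = i then D $$ (i, i) * M $$ (i, j) else 0)"
    using assms by (intro sum.cong) (auto simp: diagonal_mat_def)
  finally show ?thesis using assms(4) by simp
qed

lemma diagonal_mult_right:
  fixes D M :: "'a :: semiring_1 mat"
  assumes "D \<in> carrier_mat n n" "diagonal_mat D" "M \<in> carrier_mat n n" "i < n" "j < n"
  shows "(M * D) $$ (i, j) = M $$ (i, j) * D $$ (j, j)"
proof -
  have "(M * D) $$ (i, j) = (\<Sum>k<n. M $$ (i, k) * D $$ (k, j))"
    using assms by (simp add: scalar_prod_def lessThan_atLeast0)
  also have "\<dots> = (\<Sum>k<n. if k = j then M $$ (i, j) * D $$ (j, j) else 0)"
    using assms by (intro sum.cong) (auto simp: diagonal_mat_def)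
  finally show ?thesis using assms(5) by simp
qed

lemma pos_def_form_if_positive_definite:
  assumes "A \<in> carrier_mat n n" "symmetric_mat A" "positive_definite A"
  shows "pos_def_form {..<n} (\<lambda>i j. A $$ (i, j))"
  using assms totally_positive_imp_pos
  by (intro pos_def_form_if_eigenvalues_pos) (auto simp: positive_definite_def)

text \<open>The symmetrizing matrix \<open>D\<close> also provides the weights that make \<open>B\<close> rational, since they turn it back into \<open>A\<close>.\<close>

lemma S_mats_symmetrize:
  assumes "A \<in> S_mats n"
  obtains B d where "B \<in> carrier_mat n n" "symmetric_mat B" "eigenvalues B = eigenvalues A"
    "rational_form {..<n} (\<lambda>i j. B $$ (i, j)) d" "\<And>i. i + 1 < n \<Longrightarrow> B $$ (i, i + 1) \<noteq> 0"
proof -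
  have A: "A \<in> carrier_mat n n" and int: "\<And>i j. i < n \<Longrightarrow> j < n \<Longrightarrow> A $$ (i, j) \<in> \<int>"
    and up: "\<And>i. i + 1 < n \<Longrightarrow> A $$ (i, i + 1) \<noteq> 0" and pd: "positive_definite A"
    and "symmetrizable A"
    using assms by (auto simp: S_mats_def nonzero_upper_diagonal_def)
  then obtain D D' where D: "D \<in> carrier_mat n n" "D' \<in> carrier_mat n n" "diagonal_mat D"
    "\<And>i. i < n \<Longrightarrow> 0 < D $$ (i, i)" "D * D' = 1\<^sub>m n" "D' * D = 1\<^sub>m n" "symmetric_mat (D' * A * D)"
    by (auto simp: symmetrizable_def inverts_mat_def)
  define B where "B = D' * A * D"
  have B: "B \<in> carrier_mat n n" using A D by (simp add: B_def)
  have D': "D' $$ (i, j) = (if i = j then 1 / D $$ (i, i) else 0)" if "i < n" "j < n" for i j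
  proof -
    have "D $$ (i, i) * D' $$ (i, j) = (if i = j then 1 else 0)"
      using diagonal_mult_left[OF D(1,3,2) that] that unfolding D(5) by simp
    then show ?thesis using D(4)[OF that(1)] by (auto simp: field_simps)
  qed
  have dD': "diagonal_mat D'" using D' D(2) by (auto simp: diagonal_mat_def)
  have Bij: "B $$ (i, j) = A $$ (i, j) * D $$ (j, j) / D $$ (i, i)" if "i < n" "j < n" for i j
  proof -
    have "B $$ (i, j) = (D' * A) $$ (i, j) * D $$ (j, j)"
      unfolding B_def using A D that by (intro diagonal_mult_right) auto
    also have "(D' * A) $$ (i, j) = D' $$ (i, i) * A $$ (i, j)"
      using A D that by (intro diagonal_mult_left dD') auto
    finally show ?thesis using D' that by simp
  qed
  have sym: "symmetric_mat B" using D(7) by (simp add: B_def)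
  have "similar_mat B A"
    using A B D by (intro similar_matI[of _ _ D' D n]) (auto simp: B_def)
  then have "char_poly B = char_poly A" by (rule char_poly_similar)
  then have ev: "eigenvalues B = eigenvalues A"
    unfolding eigenvalues_def of_real_hom.char_poly_hom[OF A] of_real_hom.char_poly_hom[OF B] by simp
  have "positive_definite B" using pd ev by (simp add: positive_definite_def)
  note pf = pos_def_form_if_positive_definite[OF B sym this]
  have D0: "D $$ (i, i) \<noteq> 0" if "i < n" for i using D(4)[OF that] by simp
  have "rational_form {..<n} (\<lambda>i j. B $$ (i, j)) (\<lambda>i. D $$ (i, i))"
    unfolding rational_form_def
  proof (intro conjI ballI pf)
    fix i j assume "i \<in> {..<n}" "j \<in> {..<n}"
    then have ij: "i < n" "j < n" by auto
    show s: "B $$ (i, j) = B $$ (j, i)" by (rule symmetric_mat_index[OF sym B ij])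
    have "(B $$ (i, j))\<^sup>2 = B $$ (i, j) * B $$ (j, i)" using s by (simp add: power2_eq_square)
    also have "\<dots> = A $$ (i, j) * A $$ (j, i)"
      using D0[OF ij(1)] D0[OF ij(2)] by (simp add: Bij ij)
    also have "\<dots> \<in> \<int>" using int ij by simp
    finally show "(B $$ (i, j))\<^sup>2 \<in> \<int>" .
    have "D $$ (i, i) * B $$ (i, j) / D $$ (j, j) = A $$ (i, j)"
      using D0[OF ij(1)] D0[OF ij(2)] by (simp add: Bij ij)
    also have "\<dots> \<in> \<rat>" using int[OF ij] by (rule subsetD[OF Ints_subset_Rats])
    finally show "D $$ (i, i) * B $$ (i, j) / D $$ (j, j) \<in> \<rat>" .
  qed (use D0 in auto)
  moreover have "B $$ (i, i + 1) \<noteq> 0" if "i + 1 < n" for i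
    using up[OF that] D0[of i] D0[of "i + 1"] that by (simp add: Bij)
  ultimately show ?thesis using that B sym ev by blast
qed

lemma T_mats_square_Ints:
  assumes "A \<in> T_mats n" "i < n" "j < n"
  shows "(A $$ (i, j))\<^sup>2 \<in> \<int>"
proof -
  have "A $$ (i, j) \<in> elements_mat A" using assms by (auto simp: T_mats_def)
  then have "A $$ (i, j) \<in> {sqrt (real a) |a. a \<ge> 1} \<union> {- sqrt (real a) |a. a \<ge> 1} \<union> {0}"
    using assms unfolding T_mats_def by blast
  then show ?thesis by auto
qed

text \<open>With \<open>p\<^sub>i = b\<^sub>0\<^sub>1 b\<^sub>1\<^sub>2 \<dots> b\<^sub>i\<^sub>-\<^sub>1\<^sub>,\<^sub>i\<close>, the quotient \<open>p\<^sub>j / p\<^sub>i\<close> is the product along the path from \<open>i\<close> to \<open>j > i\<close>,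
  and \<open>b\<^sub>i\<^sub>j p\<^sub>j / p\<^sub>i\<close> closes that path to a cycle, of length at most \<open>n\<close>. Cycles of length \<open>2\<close> are squares of
  entries. The constant cycle of length \<open>3\<close>, admissible because \<open>n \<ge> 3\<close>, shows that the diagonal is rational.\<close>

lemma T_mats_rational_form:
  assumes T: "A \<in> T_mats n" and n: "3 \<le> n"
  shows "rational_form {..<n} (\<lambda>i j. A $$ (i, j)) (\<lambda>i. inverse (\<Prod>l<i. A $$ (l, l + 1)))"
proof -
  define b where "b = (\<lambda>i j. A $$ (i, j))"
  define p where "p = (\<lambda>i. \<Prod>l<i. b l (l + 1))"
  have A: "A \<in> carrier_mat n n" and sm: "symmetric_mat A" and pd: "positive_definite A"
    and up: "\<And>i. i + 1 < n \<Longrightarrow> b i (i + 1) \<noteq> 0"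
    and cyc: "rational_cycle_condition A"
    using T by (auto simp: T_mats_def nonzero_upper_diagonal_def b_def)
  have cycle: "(\<Prod>j<length is. b (is ! j) (is ! ((j + 1) mod length is))) \<in> \<rat>"
    if "3 \<le> length is" "length is \<le> n" "set is \<subseteq> {..<n}" for "is"
    using cyc A that by (auto simp: rational_cycle_condition_def b_def)
  have sym: "b i j = b j i" if "i < n" "j < n" for i j
    using symmetric_mat_index[OF sm A that] by (simp add: b_def)
  have int: "(b i j)\<^sup>2 \<in> \<int>" if "i < n" "j < n" for i j
    using T_mats_square_Ints[OF T that] by (simp add: b_def)
  have sq: "(b i j)\<^sup>2 \<in> \<rat>" if "i < n" "j < n" for i j
    using int[OF that] by (rule subsetD[OF Ints_subset_Rats])
  have p0: "p i \<noteq> 0" if "i < n" for i using up that by (auto simp: p_def)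
  have p2: "(p i)\<^sup>2 \<in> \<rat>" if "i < n" for i
    unfolding p_def prod_power_distrib using that by (intro Rats_prod sq) auto
  have padd: "p (i + m) = p i * (\<Prod>k<m. b (i + k) (i + k + 1))" for i m
    by (induction m) (simp_all add: p_def)
  have upper: "b i (i + Suc m) * p (i + Suc m) / p i \<in> \<rat>" if im: "i + Suc m < n" for i m
  proof (cases "m = 0")
    case True
    then show ?thesis
      using sq[of i "Suc i"] p0[of i] im by (simp add: p_def power2_eq_square)
  next
    case False
    let ?is = "[i..<i + Suc (Suc m)]"
    have len: "length ?is = Suc (Suc m)" by simp
    have nth: "?is ! k = i + k" if "k < Suc (Suc m)" for k using that by (intro nth_upt) simp
    have "(\<Prod>j<Suc (Suc m). b (?is ! j) (?is ! ((j + 1) mod Suc (Suc m)))) \<in> \<rat>"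
    proof -
      have "3 \<le> length ?is" "length ?is \<le> n" "set ?is \<subseteq> {..<n}"
        using False im unfolding len by auto
      from cycle[OF this] show ?thesis unfolding len .
    qed
    also have "(\<Prod>j<Suc (Suc m). b (?is ! j) (?is ! ((j + 1) mod Suc (Suc m))))
        = (\<Prod>j<Suc m. b (i + j) (i + j + 1)) * b (i + Suc m) i"
    proof -
      have "(\<Prod>j<Suc m. b (?is ! j) (?is ! ((j + 1) mod Suc (Suc m))))
          = (\<Prod>j<Suc m. b (i + j) (i + j + 1))"
      proof (rule prod.cong[OF refl])
        fix j assume "j \<in> {..<Suc m}"
        then have j: "j < Suc m" by simp
        then have "(j + 1) mod Suc (Suc m) = j + 1" by (intro mod_less) simp
        then show "b (?is ! j) (?is ! ((j + 1) mod Suc (Suc m))) = b (i + j) (i + j + 1)"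
          using j nth[of j] nth[of "j + 1"] by simp
      qed
      moreover have "?is ! Suc m = i + Suc m" "?is ! ((Suc m + 1) mod Suc (Suc m)) = i"
        using nth[of "Suc m"] nth[of 0] by simp_all
      ultimately show ?thesis unfolding prod.lessThan_Suc[of _ "Suc m"] by simp
    qed
    also have "b (i + Suc m) i = b i (i + Suc m)" using im by (intro sym) auto
    finally show ?thesis using p0[of i] im unfolding padd by (simp add: mult.commute)
  qed
  have gauge: "b i j * p j / p i \<in> \<rat>" if ij: "i < n" "j < n" for i j
  proof -
    consider m where "j = i + Suc m" | "i = j" | m where "i = j + Suc m"
      using less_imp_Suc_add[of i j] less_imp_Suc_add[of j i] nat_neq_iff[of i j] by fastforce
    then show ?thesis
    proof cases
      case 1
      then show ?thesis using upper ij by simp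
    next
      case 2
      have "(\<Prod>k<3::nat. b i i) \<in> \<rat>"
      proof -
        let ?is = "replicate 3 i"
        have "3 \<le> length ?is" "length ?is \<le> n" "set ?is \<subseteq> {..<n}"
          unfolding length_replicate using n ij by auto
        from cycle[OF this]
        have "(\<Prod>k<3. b (?is ! k) (?is ! ((k + 1) mod 3))) \<in> \<rat>" unfolding length_replicate .
        also have "(\<Prod>k<3. b (?is ! k) (?is ! ((k + 1) mod 3))) = (\<Prod>k<3::nat. b i i)"
        proof (rule prod.cong[OF refl])
          fix k :: nat assume "k \<in> {..<3}"
          then have "?is ! k = i" "?is ! ((k + 1) mod 3) = i" by (intro nth_replicate; simp)+
          then show "b (?is ! k) (?is ! ((k + 1) mod 3)) = b i i" by (simp only:)
        qed
        finally show ?thesis .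
      qed
      then have "b i i ^ 3 \<in> \<rat>" by simp
      then have "b i i ^ 3 / (b i i)\<^sup>2 \<in> \<rat>" using sq[OF ij(1) ij(1)] by (rule Rats_divide)
      moreover have "b i i ^ 3 / (b i i)\<^sup>2 = b i i" by (simp add: power3_eq_cube power2_eq_square)
      ultimately show ?thesis using 2 p0[OF ij(1)] by simp
    next
      case 3
      have "b j i * p i / p j \<in> \<rat>" using upper 3 ij by simp
      then have "(b j i * p i / p j) * ((p j)\<^sup>2 / (p i)\<^sup>2) \<in> \<rat>"
        by (rule Rats_mult[OF _ Rats_divide[OF p2[OF ij(2)] p2[OF ij(1)]]])
      also have "(b j i * p i / p j) * ((p j)\<^sup>2 / (p i)\<^sup>2) = b i j * p j / p i"
        using p0[OF ij(1)] p0[OF ij(2)] sym[OF ij] by (simp add: power2_eq_square)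
      finally show ?thesis .
    qed
  qed
  have "rational_form {..<n} b (\<lambda>i. inverse (p i))"
    unfolding rational_form_def
  proof (intro conjI ballI)
    show "pos_def_form {..<n} b"
      unfolding b_def by (rule pos_def_form_if_positive_definite[OF A sm pd])
    fix i j assume "i \<in> {..<n}" "j \<in> {..<n}"
    then have ij: "i < n" "j < n" by auto
    show "b i j = b j i" "(b i j)\<^sup>2 \<in> \<int>" using sym int ij by blast+
    have "inverse (p i) * b i j / inverse (p j) = b i j * p j / p i" by (simp add: divide_inverse)
    then show "inverse (p i) * b i j / inverse (p j) \<in> \<rat>" using gauge[OF ij] by simp
  qed (use p0 in auto)
  then show ?thesis by (simp add: b_def p_def)
qed

section \<open>Row norms and the trace bounds\<close>

definition row_norm :: "real mat \<Rightarrow> nat \<Rightarrow> real" where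
  "row_norm A i = (\<Sum>j<dim_col A. (A $$ (i, j))\<^sup>2)"

text \<open>With diagonal \<open>\<surd>a, \<surd>c\<close> and squared off-diagonal entry \<open>e\<close>, positivity of the determinant means \<open>a c > e\<^sup>2\<close>.
  If neither row norm reaches \<open>5\<close>, this leaves only \<open>e = 1\<close> and \<open>a, c \<le> 3\<close>.\<close>

lemma T_mats_2_row_bound:
  assumes T: "A \<in> T_mats 2"
  shows "\<exists>i<2. 2 \<le> row_norm A i \<and> 5 \<le> (\<Sum>j\<in>{..<2} - {i}. row_norm A j)"
proof -
  have A: "A \<in> carrier_mat 2 2" and sm: "symmetric_mat A" and pd: "positive_definite A"
    and A01: "A $$ (0, 1) \<noteq> 0"
    using T by (auto simp: T_mats_def nonzero_upper_diagonal_def)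
  have A10: "A $$ (1, 0) = A $$ (0, 1)" by (rule symmetric_mat_index[OF sm A]) auto
  have pf: "pos_def_form {..<2} (\<lambda>i j. A $$ (i, j))"
    by (rule pos_def_form_if_positive_definite[OF A sm pd])
  have Q: "0 < A $$ (0, 0) * (x * x) + 2 * A $$ (0, 1) * (x * y) + A $$ (1, 1) * (y * y)"
    if "x \<noteq> 0 \<or> y \<noteq> 0" for x y
  proof -
    define v where "v = (\<lambda>i :: nat. if i = 0 then x else y)"
    have "v 0 \<noteq> 0 \<or> v 1 \<noteq> 0" using that by (simp add: v_def)
    then have "\<exists>i\<in>{..<2}. v i \<noteq> 0" by (metis lessThan_iff pos2 one_less_numeral_iff semiring_norm(76))
    then have "0 < (\<Sum>i<2. \<Sum>j<2. A $$ (i, j) * v i * v j)"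
      using pf[unfolded pos_def_form_def, THEN spec[of _ v]] by (rule rev_mp)
    also have "\<dots> = A $$ (0, 0) * (x * x) + 2 * A $$ (0, 1) * (x * y) + A $$ (1, 1) * (y * y)"
      using A10 by (simp add: numeral_2_eq_2 v_def algebra_simps)
    finally show ?thesis .
  qed
  have s: "0 < A $$ (0, 0)" and t: "0 < A $$ (1, 1)" using Q[of 1 0] Q[of 0 1] by simp_all
  have "0 < A $$ (0, 0) * (A $$ (0, 0) * A $$ (1, 1) - (A $$ (0, 1))\<^sup>2)"
    using Q[of "A $$ (0, 1)" "- A $$ (0, 0)"] A01 by (simp add: power2_eq_square algebra_simps)
  then have det: "(A $$ (0, 1))\<^sup>2 < A $$ (0, 0) * A $$ (1, 1)" using s by (simp add: zero_less_mult_iff)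
  have nat: "\<exists>m. (A $$ (i, j))\<^sup>2 = real m" if ij: "i < 2" "j < 2" for i j
  proof -
    obtain z where z: "(A $$ (i, j))\<^sup>2 = of_int z"
      using T_mats_square_Ints[OF T ij] by (auto elim: Ints_cases)
    then have "0 \<le> z" by (metis of_int_0_le_iff zero_le_power2)
    then show ?thesis using z by (intro exI[of _ "nat z"]) simp
  qed
  obtain a where a: "(A $$ (0, 0))\<^sup>2 = real a" using nat[of 0 0] by auto
  obtain c where c: "(A $$ (1, 1))\<^sup>2 = real c" using nat[of 1 1] by auto
  obtain e where e: "(A $$ (0, 1))\<^sup>2 = real e" using nat[of 0 1] by auto
  have sq: "A $$ (0, 0) = sqrt (real a)" "A $$ (1, 1) = sqrt (real c)"
    using a c s t by (metis real_sqrt_abs abs_of_pos)+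
  have e1: "1 \<le> e" using e A01 by (cases e) auto
  have a1: "1 \<le> a" "1 \<le> c" using a c s t by (cases a; cases c; auto)+
  have "(real e)\<^sup>2 < (A $$ (0, 0) * A $$ (1, 1))\<^sup>2"
    using det e by (intro power_strict_mono) auto
  then have "(real e)\<^sup>2 < real a * real c" unfolding power_mult_distrib a c .
  then have "real (e * e) < real (a * c)" by (simp add: power2_eq_square)
  then have ac: "e * e < a * c" by (simp only: of_nat_less_iff)
  have rn: "row_norm A 0 = real a + real e" "row_norm A 1 = real e + real c"
    using A a c e A10 by (simp_all add: row_norm_def numeral_2_eq_2)
  have sets: "{..<2} - {0} = {1 :: nat}" "{..<2} - {1} = {0 :: nat}" by auto
  have big: "5 \<le> a + e \<or> 5 \<le> c + e"
  proof (rule ccontr)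
    assume "\<not> ?thesis"
    then have small: "a + e \<le> 4" "c + e \<le> 4" by auto
    have "e = 1"
    proof (rule ccontr)
      assume "e \<noteq> 1"
      then have "2 \<le> e" using e1 by simp
      then have "a \<le> e" "c \<le> e" using small by auto
      then show False using ac mult_le_mono[of a e c e] by simp
    qed
    then have ac3: "a \<in> {1, 2, 3}" "c \<in> {1, 2, 3}" "a * c \<noteq> 1" using small a1 ac by auto
    show False
      using small_diagonal_not_positive_definite[OF A A10 _ sq ac3] pd e \<open>e = 1\<close> by simp
  qed
  show ?thesis
  proof (cases "5 \<le> a + e")
    case True
    then have "5 \<le> real a + real e" by linarith
    then show ?thesis using e1 a1 rn sets by (intro exI[of _ 1]) simp
  next
    case False
    then have "5 \<le> real e + real c" using big by linarith
    then show ?thesis using e1 a1 rn sets by (intro exI[of _ 0]) simp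
  qed
qed

lemma Tr_pow2_ge:
  assumes B: "B \<in> carrier_mat n n" and sym: "symmetric_mat B"
  shows "(\<Sum>i<n. row_norm B i ^ 2 ^ k) \<le> Tr (2 ^ Suc k) B"
proof -
  have "(\<Sum>i<n. row_norm B i ^ 2 ^ k) \<le> (\<Sum>i<n. (B ^\<^sub>m (2 ^ Suc k)) $$ (i, i))"
  proof (rule sum_mono)
    fix i assume "i \<in> {..<n}"
    then show "row_norm B i ^ 2 ^ k \<le> (B ^\<^sub>m (2 ^ Suc k)) $$ (i, i)"
      using diag_pow_ge[OF B, of i k] B sym unfolding row_norm_def symmetric_mat_def by auto
  qed
  also have "\<dots> = Tr (2 ^ Suc k) B" unfolding Tr_eq_trace_pow[OF B] trace_def using B by simp
  finally show ?thesis .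
qed

text \<open>The secant of \<open>x \<mapsto> x ^ m\<close> through \<open>5\<close> and \<open>6\<close>, summed over the rows other than \<open>i\<close>. For \<open>n = 1\<close> the bound
  is \<open>2 ^ m + 5 ^ m - 6 ^ m\<close>, at most \<open>1\<close> because the increments of powers grow.\<close>

lemma trace_bounds_from_rows:
  assumes B: "B \<in> carrier_mat n n" "symmetric_mat B" and n: "1 \<le> n"
    and int: "\<And>i j. i < n \<Longrightarrow> j < n \<Longrightarrow> (B $$ (i, j))\<^sup>2 \<in> \<int>"
    and one: "n = 1 \<Longrightarrow> 1 \<le> row_norm B 0"
    and rows: "2 \<le> n \<Longrightarrow> \<exists>i<n. 2 \<le> row_norm B i \<and>
      6 * real n - 7 \<le> (\<Sum>j\<in>{..<n} - {i}. row_norm B j)"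
  shows "6 * real n - 5 \<le> Tr 2 B"
    and "2 ^ 2 ^ k + (real n - 2) * 6 ^ 2 ^ k + 5 ^ 2 ^ k \<le> Tr (2 ^ Suc k) B"
proof -
  have pow: "2 ^ m + (real n - 2) * 6 ^ m + 5 ^ m \<le> (\<Sum>i<n. row_norm B i ^ m)" for m
  proof (cases "n = 1")
    case True
    have "(2 :: real) ^ m - 1 ^ m \<le> 6 ^ m - 5 ^ m" using power_increment_mono[of 1 5 m] by simp
    moreover have "1 \<le> row_norm B 0 ^ m" using one[OF True] by (rule one_le_power)
    ultimately show ?thesis using True by simp
  next
    case False
    then obtain i where i: "i < n" "2 \<le> row_norm B i"
      "6 * real n - 7 \<le> (\<Sum>j\<in>{..<n} - {i}. row_norm B j)" using rows n by force
    let ?W = "{..<n} - {i}"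
    have card: "real (card ?W) = real n - 1" using i(1) by (simp add: of_nat_diff)
    have "(5 :: real) ^ m \<le> 6 ^ m" by (rule power_mono) auto
    have "5 ^ m + (real n - 2) * 6 ^ m = (real n - 1) * 5 ^ m + (6 ^ m - 5 ^ m) * (real n - 2)"
      by (simp add: algebra_simps)
    also have "\<dots> \<le> (real n - 1) * 5 ^ m
        + (6 ^ m - 5 ^ m) * ((\<Sum>j\<in>?W. row_norm B j) - 5 * (real n - 1))"
      using i(3) \<open>5 ^ m \<le> 6 ^ m\<close> by (intro add_left_mono mult_left_mono) auto
    also have "\<dots> = (\<Sum>j\<in>?W. 5 ^ m + (6 ^ m - 5 ^ m) * (row_norm B j - 5))"
      unfolding sum.distrib sum_distrib_left[symmetric] sum_subtractf sum_constant card
      by (simp add: algebra_simps)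
    also have "\<dots> \<le> (\<Sum>j\<in>?W. row_norm B j ^ m)"
    proof (rule sum_mono)
      fix j assume "j \<in> ?W"
      then have "row_norm B j \<in> \<int>" unfolding row_norm_def using int B(1) by (intro Ints_sum) auto
      then obtain z where z: "row_norm B j = of_int z" by (auto elim: Ints_cases)
      have "0 \<le> row_norm B j" by (simp add: row_norm_def sum_nonneg)
      then have "row_norm B j = real (nat z)" using z by simp
      then show "5 ^ m + (6 ^ m - 5 ^ m) * (row_norm B j - 5) \<le> row_norm B j ^ m"
        using power_secant_bound[of 5 m "nat z"] by simp
    qed
    finally have "5 ^ m + (real n - 2) * 6 ^ m \<le> (\<Sum>j\<in>?W. row_norm B j ^ m)" .
    moreover have "2 ^ m \<le> row_norm B i ^ m" using i(2) by (intro power_mono) auto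
    moreover have "(\<Sum>j<n. row_norm B j ^ m) = row_norm B i ^ m + (\<Sum>j\<in>?W. row_norm B j ^ m)"
      using i(1) by (intro sum.remove) auto
    ultimately show ?thesis by linarith
  qed
  show "2 ^ 2 ^ k + (real n - 2) * 6 ^ 2 ^ k + 5 ^ 2 ^ k \<le> Tr (2 ^ Suc k) B"
    using pow[of "2 ^ k"] Tr_pow2_ge[OF B, of k] by linarith
  show "6 * real n - 5 \<le> Tr 2 B"
    using pow[of 1] Tr_pow2_ge[OF B, of 0] by simp
qed

lemma row_bound_if_rational_form:
  assumes B: "B \<in> carrier_mat n n" and f: "rational_form {..<n} (\<lambda>i j. B $$ (i, j)) d"
    and up: "\<And>i. i + 1 < n \<Longrightarrow> B $$ (i, i + 1) \<noteq> 0" and n: "2 \<le> n"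
  shows "\<exists>i<n. 2 \<le> row_norm B i \<and> 6 * real n - 7 \<le> (\<Sum>j\<in>{..<n} - {i}. row_norm B j)"
proof -
  have "covers {..<n} (\<lambda>i j. B $$ (i, j)) {i}" if "i < n" for i
    using rational_formD(1)[OF f] up that by (intro covers_of_path) auto
  then show ?thesis using row_deletion_bound[OF f] n B by (auto simp: row_norm_def)
qed

theorem theorem1:
  fixes n :: nat and A :: "real mat"
  assumes "n \<ge> 1" and "A \<in> S_mats n \<union> T_mats n"
  shows "Tr 2 A \<ge> 6 * real n - 5 \<and>
    (\<forall>k\<ge>1. Tr (2 ^ k) A \<ge> 2 ^ 2 ^ (k - 1) + (real n - 2) * 6 ^ 2 ^ (k - 1) + 5 ^ 2 ^ (k - 1))"
proof -
  obtain B where B: "B \<in> carrier_mat n n" "symmetric_mat B" and ev: "eigenvalues B = eigenvalues A"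
    and int: "\<And>i j. i < n \<Longrightarrow> j < n \<Longrightarrow> (B $$ (i, j))\<^sup>2 \<in> \<int>"
    and pf: "pos_def_form {..<n} (\<lambda>i j. B $$ (i, j))"
    and rows: "2 \<le> n \<Longrightarrow> \<exists>i<n. 2 \<le> row_norm B i \<and>
      6 * real n - 7 \<le> (\<Sum>j\<in>{..<n} - {i}. row_norm B j)"
  proof (cases "A \<in> S_mats n")
    case True
    then obtain B d where B: "B \<in> carrier_mat n n" "symmetric_mat B" "eigenvalues B = eigenvalues A"
      "rational_form {..<n} (\<lambda>i j. B $$ (i, j)) d" "\<And>i. i + 1 < n \<Longrightarrow> B $$ (i, i + 1) \<noteq> 0"
      by (rule S_mats_symmetrize) blast
    then show ?thesis
      using row_bound_if_rational_form[OF B(1,4,5)]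
      by (intro that[of B]) (auto simp: rational_form_def)
  next
    case False
    then have T: "A \<in> T_mats n" using assms(2) by blast
    then have A: "A \<in> carrier_mat n n" "symmetric_mat A" "positive_definite A"
      "\<And>i. i + 1 < n \<Longrightarrow> A $$ (i, i + 1) \<noteq> 0"
      by (auto simp: T_mats_def nonzero_upper_diagonal_def)
    have rows: "\<exists>i<n. 2 \<le> row_norm A i \<and> 6 * real n - 7 \<le> (\<Sum>j\<in>{..<n} - {i}. row_norm A j)"
      if "2 \<le> n"
    proof (cases "n = 2")
      case True
      then show ?thesis using T_mats_2_row_bound[of A] T by simp
    next
      case False
      then have "3 \<le> n" using that by simp
      then show ?thesis
        using row_bound_if_rational_form[OF A(1) T_mats_rational_form[OF T] A(4) that] by blast
    qed
    show ?thesis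
      using T_mats_square_Ints[OF T] rows pos_def_form_if_positive_definite[OF A(1-3)]
      by (intro that[of A] A refl) auto
  qed
  have one: "1 \<le> row_norm B 0" if "n = 1"
  proof -
    have "\<exists>i\<in>{..<n}. (1 :: real) \<noteq> 0" using that by simp
    then have "0 < (\<Sum>i<n. \<Sum>j<n. B $$ (i, j) * 1 * 1)"
      using pf unfolding pos_def_form_def by (elim allE[of _ "\<lambda>_. 1"]) (rule mp)
    then have "B $$ (0, 0) \<noteq> 0" using that by auto
    then show ?thesis using square_ge_1[OF int[of 0 0]] that B(1) by (simp add: row_norm_def)
  qed
  have "Tr k A = Tr k B" for k using ev by (simp add: Tr_def)
  moreover have "2 ^ 2 ^ (k - 1) + (real n - 2) * 6 ^ 2 ^ (k - 1) + 5 ^ 2 ^ (k - 1) \<le> Tr (2 ^ k) B"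
    if "1 \<le> k" for k
    using trace_bounds_from_rows(2)[OF B assms(1) int one rows, of "k - 1"] that by simp
  moreover have "6 * real n - 5 \<le> Tr 2 B"
    by (rule trace_bounds_from_rows(1)[OF B assms(1) int one rows])
  ultimately show ?thesis by simp
qed

end
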